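(* Let $f:\mathbb{R}^d\to\mathbb{R}$ with $f,\hat f\in L^1(\mathbb{R}^d)$, let $\lambda\ge0$, let $p:\mathbb{R}^d\to[0,\infty)$ be a probability density, and let $\{\omega_k\}_{k=1}^\infty$ be a sequence of samples drawn independently from $p$. Let $\rho:\mathbb{R}^d\to[0,\infty)$ be the probability density of the $x$-data, and suppose that $\rho$ has support on all of $\mathbb{R}^d$ and satisfies $\hat\rho\in C^1$. For each $K$ let $\boldsymbol{\hat\zeta}_K=(\hat\zeta_1,\dots,\hat\zeta_K)\in\mathbb{C}^K$ (the entries depend on $K$) be the solution of the normal equations $$\sum_{k=1}^K\hat\rho(\omega_\ell-\omega_k)\hat\zeta_k+\lambda\hat\zeta_\ell=\widehat{(f\rho)}(\omega_\ell),\qquad \ell=1,\dots,K,$$ put $\hat z_k:=K\,p(\omega_k)\hat\zeta_k$, and define the empirical measures $$\hat Z_K(\omega):=\frac1K\sum_{k=1}^K\frac{\hat z_k}{p(\omega_k)}\delta(\omega-\omega_k).$$ Suppose that: (A1) there exists a constant $C$ such that $\sum_{k=1}^K|\hat\zeta_k|\equiv\frac1K\sum_{k=1}^K\frac{|\hat z_k|}{p(\omega_k)}\le C$ for all $K>0$; (A2) $\lim_{K\to\infty}\max_{k\in\{1,\dots,K\}}|\hat\zeta_k|\equiv\lim_{K\to\infty}\max_{k\in\{1,\dots,K\}}\frac{|\hat z_k|}{K\,p(\omega_k)}=0$; (A3) there is a bounded open set $\mathcal{U}\subset\mathbb{R}^d$ such that $\mathrm{supp}\,\hat f\subset\mathrm{supp}\,p\subset\mathcal{U}$;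 (A4) the sequence $\{\omega_k\}_{k=1}^\infty$ is dense in the support of $p$, i.e. $\overline{\{\omega_k\}_{k=1}^\infty}=\mathrm{supp}\,p$. Then $$\lim_{\varepsilon\to0+}\lim_{K\to\infty}\int_{\mathbb{R}^d}\phi_\varepsilon(\cdot-\omega')\,\hat Z_K(d\omega')=\hat f\qquad\text{in }L^1(\mathbb{R}^d),$$ where $\phi_\varepsilon:\mathbb{R}^d\to\mathbb{R}$ are nonnegative smooth functions with support in the ball $\mathcal{B}_\varepsilon=\{\omega\in\mathbb{R}^d:|\omega|\le\varepsilon\}$ and satisfying $\int_{\mathbb{R}^d}\phi_\varepsilon(\omega)\,d\omega=1$.
   Context: The Fourier transform is $\hat g(\omega)=(2\pi)^{-d/2}\int_{\mathbb{R}^d}g(x)e^{-\mathrm{i}\omega\cdot x}\,dx$, with inverse representation $g(x)=(2\pi)^{-d/2}\int_{\mathbb{R}^d}\hat g(\omega)e^{\mathrm{i}\omega\cdot x}\,d\omega$ when $g,\hat g\in L^1(\mathbb{R}^d)$; $\widehat{(f\rho)}$ is the Fourier transform of the product $f\rho$. Here $f$ is the target function to be approximated, $\lambda$ is a Tikhonov regularization parameter, and $\mathrm{supp}$ denotes the support. $\delta(\omega-\omega_k)$ is the unit Dirac mass at $\omega_k$, so $\hat Z_K=\sum_{k=1}^K\hat\zeta_k\delta(\cdot-\omega_k)$ is a complex measure on $\mathbb{R}^d$.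
   Formalization: The limit is proved to be (2π)^{-d/2} f̂ instead of f̂: with the stated Fourier convention and normal equations, the transform of fρ is (2π)^{-d/2} times the convolution of ρ̂ and f̂, so the printed limit is off by this factor unless f̂ = 0. *)

theory Defs
  imports "HOL-Probability.Probability"
begin

definition fourier :: "('a::euclidean_space \<Rightarrow> complex) \<Rightarrow> 'a \<Rightarrow> complex" where
  "fourier g w = complex_of_real ((2 * pi) powr (- (real DIM('a) / 2))) *
     (LINT x|lborel. g x * exp (- (\<i> * complex_of_real (w \<bullet> x))))"

definition prob_density :: "('a::euclidean_space \<Rightarrow> real) \<Rightarrow> bool" where
  "prob_density g \<longleftrightarrow> (\<forall>x. 0 \<le> g x) \<and> has_bochner_integral lborel g 1"

(* The support modulo Lebesgue null sets: the complement of the largest open set on which g = 0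
   almost everywhere. For a density it is the support of the measure with that density, whichever
   version of the density is chosen; for continuous g it is the closure of {x. g x \<noteq> 0}. *)
definition supp :: "('a::euclidean_space \<Rightarrow> 'b::zero) \<Rightarrow> 'a set" where
  "supp g = {x. \<forall>U. open U \<longrightarrow> x \<in> U \<longrightarrow> \<not> (AE y in lborel. y \<in> U \<longrightarrow> g y = 0)}"

primrec C_k :: "nat \<Rightarrow> ('a::euclidean_space \<Rightarrow> 'b::real_normed_vector) \<Rightarrow> bool" where
  "C_k 0 g \<longleftrightarrow> continuous_on UNIV g"
| "C_k (Suc n) g \<longleftrightarrow> (\<forall>x. g differentiable (at x)) \<and>
     (\<forall>v. C_k n (\<lambda>x. frechet_derivative g (at x) v))"

definition smooth :: "('a::euclidean_space \<Rightarrow> 'b::real_normed_vector) \<Rightarrow> bool" where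
  "smooth g \<longleftrightarrow> (\<forall>n. C_k n g)"

(* The integrability conditions are needed because the Bochner integral of a non-integrable
   function is 0 by convention. *)
definition tendsto_L1 ::
  "('i \<Rightarrow> 'a::euclidean_space \<Rightarrow> complex) \<Rightarrow> ('a \<Rightarrow> complex) \<Rightarrow> 'i filter \<Rightarrow> bool" where
  "tendsto_L1 F g net \<longleftrightarrow> (\<forall>\<^sub>F i in net. integrable lborel (F i)) \<and> integrable lborel g \<and>
     ((\<lambda>i. LINT x|lborel. norm (F i x - g x)) \<longlongrightarrow> 0) net"

(* In the unitary normalisation of the Fourier transform,
   fourier (f \<rho>) = (2 pi) powr (- d / 2) * (fourier \<rho> convolved with fourier f),
   so for lam = 0 these equations are a discretisation of
   fourier \<rho> * Z = fourier \<rho> * ((2 pi) powr (- d / 2) fourier f), with * the convolution. *)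
definition normal_equations ::
  "('a::euclidean_space \<Rightarrow> real) \<Rightarrow> ('a \<Rightarrow> real) \<Rightarrow> real \<Rightarrow> (nat \<Rightarrow> 'a) \<Rightarrow> nat \<Rightarrow> (nat \<Rightarrow> complex) \<Rightarrow> bool"
where
  "normal_equations f \<rho> lam \<omega> K \<zeta> \<longleftrightarrow>
     (\<forall>l\<in>{1..K}. (\<Sum>k=1..K. fourier (\<lambda>x. complex_of_real (\<rho> x)) (\<omega> l - \<omega> k) * \<zeta> k)
         + complex_of_real lam * \<zeta> l
       = fourier (\<lambda>x. complex_of_real (f x * \<rho> x)) (\<omega> l))"

definition z_hat ::
  "('a \<Rightarrow> real) \<Rightarrow> (nat \<Rightarrow> 'a) \<Rightarrow> nat \<Rightarrow> (nat \<Rightarrow> complex) \<Rightarrow> nat \<Rightarrow> complex" where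
  "z_hat p \<omega> K \<zeta> k = of_nat K * complex_of_real (p (\<omega> k)) * \<zeta> k"

(* The integral of g against the complex measure
   (1/K) * (\<Sum>k=1..K. z k / p (\<omega> k) * Dirac mass at \<omega> k);
   the Dirac mass at a is the measure return borel a. *)
definition empirical_integral ::
  "('a::euclidean_space \<Rightarrow> real) \<Rightarrow> (nat \<Rightarrow> 'a) \<Rightarrow> nat \<Rightarrow> (nat \<Rightarrow> complex) \<Rightarrow> ('a \<Rightarrow> real) \<Rightarrow> complex"
where
  "empirical_integral p \<omega> K z g =
     1 / of_nat K * (\<Sum>k=1..K. z k / complex_of_real (p (\<omega> k)) *
       complex_of_real (LINT w|return borel (\<omega> k). g w))"

definition mollified ::
  "('a::euclidean_space \<Rightarrow> real) \<Rightarrow> (nat \<Rightarrow> 'a) \<Rightarrow> nat \<Rightarrow> (nat \<Rightarrow> complex) \<Rightarrow> ('a \<Rightarrow> real) \<Rightarrow> 'a \<Rightarrow> complex"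
where
  "mollified p \<omega> K \<zeta> \<phi> w = empirical_integral p \<omega> K (z_hat p \<omega> K \<zeta>) (\<lambda>w'. \<phi> (w - w'))"

end

theory Submission
  imports Defs
begin

text \<open>
  Write $c = (2\pi)^{-d/2}$, let $S$ be the support of $p$, which is compact,
  and consider the transforms
  $u_K(x) = \sum_k \hat\zeta_k e^{i\omega_k\cdot x}$ of the empirical measure and
  $v(x) = \int c\hat f(w) e^{iw\cdot x}\,dw$ of the claimed limit. Fourier inversion
  (\<open>fourier_inversion\<close>) says that $f = v$ almost everywhere, so the right-hand side of the normal
  equations is an integral of $v\rho$, and the equations say precisely that the
  residual $R_K(w) = \int \rho\,(u_K - v)\, e^{-iw\cdot x}\,dx$ equals
  $-(\lambda/c)\,\hat\zeta_l$ at each sample $w = \omega_l$ with $l \le K$.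

  The heart is the energy $E_K = \int \rho\,|u_K - v|^2$ (locale \<open>discrete_deconvolution\<close>).
  Expanding one factor $\overline{u_K - v}$ into characters gives
  $E_K = -(\lambda/c)\sum_k|\hat\zeta_k|^2 - \int \overline{c\hat f}\,R_K$.
  The first term is nonpositive. For the second, $R_K \to 0$ on all of $S$: at a sample because the largest weight tends to $0$, and at
  other points because the bound on $\sum_k|\hat\zeta_k|$ makes the functions $R_K$ equicontinuous
  and the samples are dense in $S$. Since $\hat f$ vanishes off $S$, dominated convergence gives $E_K \to 0$.

  As all the exponents lie in the bounded set $S$, the functions $u_K - v$ are uniformly Lipschitz;
  as $\rho$ charges every ball, $E_K \to 0$ therefore forces $u_K \to v$ pointwise
  (\<open>characters_converge\<close>). By Stone--Weierstrass trigonometric sums are uniformly dense in the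
  continuous functions on $S$, so with the bound on the total variation the empirical measures converge to $c\hat f$ when tested
  against any continuous function (\<open>weak_convergence_from_characters\<close>). Testing with
  $\phi_\varepsilon(x - \cdot)$ gives the limit in $K$, which is $\phi_\varepsilon * c\hat f$,
  and the limit $\varepsilon \to 0$ is the $L^1$ approximate identity property
  (\<open>approximate_identity_L1\<close>), a consequence of the continuity of translation in $L^1$.

  The argument is pathwise: almost surely $p(\omega_k) \ne 0$ for all $k$, so that the weights
  $\hat z_k / p(\omega_k)$ really are $K\hat\zeta_k$, and everything else is deterministic.
\<close>

section \<open>Affine changes of variable\<close>

lemma borel_measurable_cis [measurable]: "cis \<in> borel_measurable borel"
  by (intro borel_measurable_continuous_onI continuous_intros)

lemma integrable_affine:
  fixes f :: "'a::euclidean_space \<Rightarrow> 'b::{banach, second_countable_topology}"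
  assumes f: "integrable lborel f" and c: "c \<noteq> 0"
  shows "integrable lborel (\<lambda>x. f (t + c *\<^sub>R x))"
proof -
  have [measurable]: "f \<in> borel_measurable borel" using f by auto
  have "integrable (density (distr lborel borel (\<lambda>x. t + c *\<^sub>R x)) (\<lambda>_. ennreal (\<bar>c\<bar> ^ DIM('a)))) f"
    using f by (subst (asm) lborel_affine[OF c, of t]) simp
  then have "integrable lborel (\<lambda>x. \<bar>c\<bar> ^ DIM('a) *\<^sub>R f (t + c *\<^sub>R x))"
    by (simp add: integrable_density integrable_distr_eq)
  from integrable_scaleR_right[OF this, of "inverse (\<bar>c\<bar> ^ DIM('a))"] show ?thesis
    using c by simp
qed

lemma integral_affine:
  fixes f :: "'a::euclidean_space \<Rightarrow> 'b::{banach, second_countable_topology}"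
  assumes [measurable]: "f \<in> borel_measurable borel" and c: "c \<noteq> 0"
  shows "integral\<^sup>L lborel f = \<bar>c\<bar> ^ DIM('a) *\<^sub>R (LINT x|lborel. f (t + c *\<^sub>R x))"
  by (subst lborel_affine[OF c, of t]) (simp add: integral_density integral_distr)

section \<open>Continuity of translation in the L1 norm\<close>

lemma integrable_translate:
  fixes f :: "'a::euclidean_space \<Rightarrow> 'b::{banach, second_countable_topology}"
  shows "integrable lborel f \<Longrightarrow> integrable lborel (\<lambda>x. f (x - y))"
  using integrable_affine[of f 1 "- y"] by simp

lemma integral_translate:
  fixes f :: "'a::euclidean_space \<Rightarrow> 'b::{banach, second_countable_topology}"
  shows "f \<in> borel_measurable borel \<Longrightarrow> (LINT x|lborel. f (x - y)) = integral\<^sup>L lborel f"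
  using integral_affine[of f 1 "- y"] by simp

definition L1_modulus :: "('a::euclidean_space \<Rightarrow> 'b::{banach, second_countable_topology}) \<Rightarrow> 'a \<Rightarrow> real" where
  "L1_modulus g y = (LINT x|lborel. norm (g (x - y) - g x))"

lemma L1_modulus_nonneg: "0 \<le> L1_modulus g y"
  by (simp add: L1_modulus_def)

text \<open>
  Translation is an isometry of $L^1$, so a small change of $g$ in norm changes its modulus uniformly
  in the shift. This reduces continuity at $0$ to a dense class.
\<close>
lemma L1_modulus_perturb:
  assumes g: "integrable lborel g" and h: "integrable lborel h"
  shows "L1_modulus g y \<le> L1_modulus h y + 2 * (LINT x|lborel. norm (g x - h x))"
proof -
  have [measurable]: "g \<in> borel_measurable borel" "h \<in> borel_measurable borel" using g h by auto
  note int = g h integrable_translate[OF g, of y] integrable_translate[OF h, of y]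
  have "L1_modulus g y \<le> (LINT x|lborel. norm (h (x - y) - h x)
      + (norm (g (x - y) - h (x - y)) + norm (g x - h x)))"
    unfolding L1_modulus_def
  proof (rule integral_mono)
    fix x
    have "g (x - y) - g x = (h (x - y) - h x) + ((g (x - y) - h (x - y)) - (g x - h x))"
      by simp
    also have "norm \<dots> \<le> norm (h (x - y) - h x)
      + (norm (g (x - y) - h (x - y)) + norm (g x - h x))"
      by (rule order_trans[OF norm_triangle_ineq add_left_mono[OF norm_triangle_ineq4]])
    finally show "norm (g (x - y) - g x) \<le> norm (h (x - y) - h x)
      + (norm (g (x - y) - h (x - y)) + norm (g x - h x))" .
  qed (intro Bochner_Integration.integrable_add integrable_norm Bochner_Integration.integrable_diff int)+
  also have "\<dots> = L1_modulus h y + ((LINT x|lborel. norm (g (x - y) - h (x - y)))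
      + (LINT x|lborel. norm (g x - h x)))"
    using int by (subst Bochner_Integration.integral_add) (simp_all add: L1_modulus_def)
  also have "(LINT x|lborel. norm (g (x - y) - h (x - y))) = (LINT x|lborel. norm (g x - h x))"
    by (rule integral_translate[of "\<lambda>x. norm (g x - h x)"]) simp
  finally show ?thesis by simp
qed

lemma L1_modulus_le:
  assumes g: "integrable lborel g"
  shows "L1_modulus g y \<le> 2 * (LINT x|lborel. norm (g x))"
  using L1_modulus_perturb[OF g, of "\<lambda>_. 0" y] by (simp add: L1_modulus_def)

lemma borel_measurable_L1_modulus:
  assumes "integrable lborel g"
  shows "L1_modulus g \<in> borel_measurable borel"
proof -
  have [measurable]: "g \<in> borel_measurable borel" using assms by auto
  show ?thesis unfolding L1_modulus_def
    by (intro lborel.borel_measurable_lebesgue_integral) measurable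
qed

text \<open>
  For an open set $U$ the overlap $U \cap (U + y)$ tends to $U$ pointwise: each point of $U$ stays
  inside after a small shift. Points outside $U$ need not behave, which is why the full symmetric
  difference is not estimated pointwise. Its two halves have the same measure, because $U$ and $U + y$
  have, and the half $U - (U + y)$ is controlled by dominated convergence.
\<close>
lemma L1_modulus_indicator_open:
  fixes U :: "'a::euclidean_space set"
  assumes U: "open U" "emeasure lborel U < \<infinity>" and Y: "Y \<longlonglongrightarrow> 0"
  shows "(\<lambda>n. L1_modulus (indicator U :: 'a \<Rightarrow> real) (Y n)) \<longlonglongrightarrow> 0"
proof -
  have [measurable]: "U \<in> sets borel" using U by simp
  let ?I = "indicator U :: 'a \<Rightarrow> real"
  have I: "integrable lborel ?I" using U by simp
  let ?m = "\<lambda>y x. max 0 (?I x - ?I (x - y))"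
  have m: "integrable lborel (?m y)" for y
    using integrable_translate[OF I, of y] I by (intro integrable_max) auto
  have eq: "L1_modulus ?I y = 2 * (LINT x|lborel. ?m y x)" for y
  proof -
    \<comment> \<open>$|a - b| = (a - b) + 2\max(0, b - a)$, and the first summand integrates to $0$\<close>
    have "L1_modulus ?I y = (LINT x|lborel. (?I (x - y) - ?I x) + 2 * ?m y x)"
      unfolding L1_modulus_def by (intro Bochner_Integration.integral_cong) (auto simp: abs_if max_def)
    also have "\<dots> = (LINT x|lborel. ?I (x - y)) - integral\<^sup>L lborel ?I + 2 * (LINT x|lborel. ?m y x)"
      using m integrable_translate[OF I, of y] I by simp
    also have "(LINT x|lborel. ?I (x - y)) = integral\<^sup>L lborel ?I"
      by (rule integral_translate) simp
    finally show ?thesis by simp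
  qed
  have "(\<lambda>n. LINT x|lborel. ?m (Y n) x) \<longlonglongrightarrow> (LINT x|(lborel::'a measure). (0::real))"
  proof (rule integral_dominated_convergence[where w = ?I])
    show "AE x in lborel. (\<lambda>n. ?m (Y n) x) \<longlonglongrightarrow> 0"
    proof (rule AE_I2)
      fix x
      show "(\<lambda>n. ?m (Y n) x) \<longlonglongrightarrow> 0"
      proof (cases "x \<in> U")
        case True
        have "(\<lambda>n. x - Y n) \<longlonglongrightarrow> x" using tendsto_diff[OF tendsto_const Y, of x] by simp
        then have "\<forall>\<^sub>F n in sequentially. x - Y n \<in> U"
          using U(1) True by (rule topological_tendstoD)
        then have "\<forall>\<^sub>F n in sequentially. ?m (Y n) x = 0"
          by eventually_elim (simp add: True)
        then show ?thesis by (rule tendsto_eventually)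
      qed simp
    qed
    show "\<And>n. AE x in lborel. norm (?m (Y n) x) \<le> ?I x"
      by (auto simp: indicator_def)
  qed (use I m in auto)
  then show ?thesis unfolding eq using tendsto_mult_left[of _ 0 sequentially 2] by fastforce
qed

lemma L1_modulus_approx:
  assumes g: "integrable lborel g"
    and h: "\<And>e. e > 0 \<Longrightarrow> \<exists>h. integrable lborel h \<and> (\<lambda>n. L1_modulus h (Y n)) \<longlonglongrightarrow> 0
              \<and> (LINT x|lborel. norm (g x - h x)) < e"
  shows "(\<lambda>n. L1_modulus g (Y n)) \<longlonglongrightarrow> 0"
proof (rule LIMSEQ_I)
  fix e :: real assume "e > 0"
  then obtain h where h: "integrable lborel h" "(\<lambda>n. L1_modulus h (Y n)) \<longlonglongrightarrow> 0"
    "(LINT x|lborel. norm (g x - h x)) < e / 4"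
    using assms(2)[of "e / 4"] by auto
  from LIMSEQ_D[OF h(2), of "e / 2"] \<open>e > 0\<close> obtain no where
    no: "\<And>n. n \<ge> no \<Longrightarrow> L1_modulus h (Y n) < e / 2" by (auto simp: L1_modulus_nonneg)
  show "\<exists>no. \<forall>n\<ge>no. norm (L1_modulus g (Y n) - 0) < e"
  proof (intro exI allI impI)
    fix n assume "n \<ge> no"
    from no[OF this] h(3) L1_modulus_perturb[OF g h(1), of "Y n"]
    have "L1_modulus g (Y n) < e" by linarith
    then show "norm (L1_modulus g (Y n) - 0) < e" using L1_modulus_nonneg[of g "Y n"] by simp
  qed
qed

text \<open>
  Integrable functions are $L^1$ limits of combinations of indicator functions of sets of finite measure,
  and by outer regularity such an indicator is $L^1$-close to that of an open set. The shifts run through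
  a sequence because dominated convergence is a statement about sequences.
\<close>
lemma L1_modulus_tendsto_sequentially:
  fixes g :: "'a::euclidean_space \<Rightarrow> 'b::{banach, second_countable_topology}"
  assumes g: "integrable lborel g" and Y: "Y \<longlonglongrightarrow> 0"
  shows "(\<lambda>n. L1_modulus g (Y n)) \<longlonglongrightarrow> 0"
  using g
proof (induction rule: integrable_induct)
  case (base A c)
  then have A [measurable]: "A \<in> sets borel" "emeasure lborel A < \<infinity>" by simp_all
  have "(\<lambda>n. L1_modulus (indicator A :: 'a \<Rightarrow> real) (Y n)) \<longlonglongrightarrow> 0"
  proof (rule L1_modulus_approx)
    fix e :: real assume "e > 0"
    from outer_regular_lborel[OF A(1) this] obtain U where
      U: "open U" "A \<subseteq> U" "emeasure lborel (U - A) < e" by blast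
    have [measurable]: "U \<in> sets borel" using U by simp
    have "emeasure lborel U = emeasure lborel A + emeasure lborel (U - A)"
      using U by (subst plus_emeasure) (auto intro!: arg_cong2[where f = emeasure])
    also have "\<dots> < \<infinity>" using A(2) U(3) by (metis ennreal_add_eq_top ennreal_less_top infinity_ennreal_def less_top order.strict_trans)
    finally have fin: "emeasure lborel U < \<infinity>" .
    have "(LINT x|lborel. norm (indicator A x - indicator U x :: real)) = (LINT x|lborel. indicator (U - A) x)"
      using U by (intro Bochner_Integration.integral_cong) (auto simp: indicator_def)
    also have "\<dots> = measure lborel (U - A)" by simp
    also have "\<dots> < e"
      using U(3) \<open>e > 0\<close> by (simp add: measure_def enn2real_less_iff order.strict_trans[OF _ ennreal_less_top])
    finally have "(LINT x|lborel. norm (indicator A x - indicator U x :: real)) < e" .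
    then show "\<exists>h. integrable lborel h \<and> (\<lambda>n. L1_modulus h (Y n)) \<longlonglongrightarrow> 0
              \<and> (LINT x|lborel. norm (indicator A x - h x :: real)) < e"
      using fin L1_modulus_indicator_open[OF U(1) fin Y]
      by (intro exI[of _ "indicator U"]) simp
  qed (use A in simp)
  then have "(\<lambda>n. L1_modulus (indicator A :: 'a \<Rightarrow> real) (Y n) * norm c) \<longlonglongrightarrow> 0"
    by (rule tendsto_mult_left_zero)
  then show ?case
    by (simp add: L1_modulus_def scaleR_diff_left[symmetric])
next
  case (add f g)
  have sum: "(\<lambda>n. L1_modulus f (Y n) + L1_modulus g (Y n)) \<longlonglongrightarrow> 0"
    using add tendsto_add_zero by blast
  have "L1_modulus (\<lambda>x. f x + g x) y \<le> L1_modulus f y + L1_modulus g y" for y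
  proof -
    note int = add(1,2) integrable_translate[OF add(1), of y] integrable_translate[OF add(2), of y]
    have "L1_modulus (\<lambda>x. f x + g x) y \<le> (LINT x|lborel. norm (f (x - y) - f x) + norm (g (x - y) - g x))"
      unfolding L1_modulus_def
    proof (rule integral_mono)
      show "norm (f (x - y) + g (x - y) - (f x + g x)) \<le> norm (f (x - y) - f x) + norm (g (x - y) - g x)" for x
        by (rule norm_diff_triangle_ineq)
    qed (intro Bochner_Integration.integrable_add integrable_norm Bochner_Integration.integrable_diff int)+
    then show ?thesis using int by (simp add: L1_modulus_def)
  qed
  then show ?case
    by (intro Lim_null_comparison[OF _ sum] always_eventually) (simp add: L1_modulus_nonneg)
next
  case (lim f s)
  show ?case
  proof (rule L1_modulus_approx)
    fix e :: real assume "e > 0"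
    have [measurable]: "\<And>i. s i \<in> borel_measurable borel" "f \<in> borel_measurable borel"
      using lim by auto
    have "(\<lambda>i. LINT x|lborel. norm (f x - s i x)) \<longlonglongrightarrow> (LINT x|(lborel::'a measure). (0::real))"
    proof (rule integral_dominated_convergence[where w = "\<lambda>x. 3 * norm (f x)"])
      show "AE x in lborel. (\<lambda>i. norm (f x - s i x)) \<longlonglongrightarrow> 0"
      proof (rule AE_I2)
        fix x :: 'a assume "x \<in> space lborel"
        from tendsto_norm[OF tendsto_diff[OF tendsto_const lim(2)[OF this], of "f x"]]
        show "(\<lambda>i. norm (f x - s i x)) \<longlonglongrightarrow> 0" by simp
      qed
      have "norm (f x - s i x) \<le> 3 * norm (f x)" for i x
        using norm_triangle_ineq4[of "f x" "s i x"] lim(3)[of x i] by simp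
      then show "\<And>i. AE x in lborel. norm (norm (f x - s i x)) \<le> 3 * norm (f x)" by simp
    qed (use lim(4) in auto)
    from LIMSEQ_D[OF this \<open>e > 0\<close>] obtain i where "(LINT x|lborel. norm (f x - s i x)) < e" by auto
    then show "\<exists>h. integrable lborel h \<and> (\<lambda>n. L1_modulus h (Y n)) \<longlonglongrightarrow> 0
              \<and> (LINT x|lborel. norm (f x - h x)) < e"
      using lim(1,5) by blast
  qed (rule lim(4))
qed

theorem L1_modulus_tendsto_0:
  assumes "integrable lborel g"
  shows "(L1_modulus g \<longlongrightarrow> 0) (nhds 0)"
proof -
  have "\<forall>Y. Y \<longlonglongrightarrow> 0 \<longrightarrow> (\<lambda>n. L1_modulus g (Y n)) \<longlonglongrightarrow> L1_modulus g 0"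
    using L1_modulus_tendsto_sequentially[OF assms] by (simp add: L1_modulus_def)
  then have "isCont (L1_modulus g) 0"
    by (simp add: continuous_at_sequentially comp_def)
  then show ?thesis by (simp add: isCont_def tendsto_at_iff_tendsto_nhds) (simp add: L1_modulus_def)
qed

text \<open>
  Because $k$ has integral $1$, the error is $\int k(z)\,(g(x - rz) - g(x))\,dz$, and Fubini moves the
  $L^1$ norm in $x$ inside. The scale $r$ allows one lemma for both uses: a fixed Gaussian with
  $r \to 0$ in the inversion theorem, and mollifiers of shrinking support with $r = 1$.
\<close>
lemma convolution_L1_error:
  fixes k :: "'a::euclidean_space \<Rightarrow> real" and g :: "'a \<Rightarrow> complex"
  assumes k: "integrable lborel k" "\<And>z. 0 \<le> k z" "integral\<^sup>L lborel k = 1"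
    and g: "integrable lborel g"
  shows "integrable lborel (\<lambda>x. LINT z|lborel. k z *\<^sub>R g (x - r *\<^sub>R z))"
    and "(LINT x|lborel. norm ((LINT z|lborel. k z *\<^sub>R g (x - r *\<^sub>R z)) - g x))
           \<le> (LINT z|lborel. k z * L1_modulus g (r *\<^sub>R z))"
proof -
  have [measurable]: "g \<in> borel_measurable borel" "k \<in> borel_measurable borel" using g k by auto
  define h where "h z x = k z *\<^sub>R (g (x - r *\<^sub>R z) - g x)" for z x
  have norm_h: "(LINT x|lborel. norm (h z x)) = k z * L1_modulus g (r *\<^sub>R z)" for z
    by (simp add: h_def L1_modulus_def k(2))
  have kN: "integrable lborel (\<lambda>z. k z * L1_modulus g (r *\<^sub>R z))"
  proof (rule Bochner_Integration.integrable_bound[of _ "\<lambda>z. k z * (2 * (LINT x|lborel. norm (g x)))"])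
    show "(\<lambda>z. k z * L1_modulus g (r *\<^sub>R z)) \<in> borel_measurable lborel"
      using borel_measurable_L1_modulus[OF g] by measurable
    show "AE z in lborel. norm (k z * L1_modulus g (r *\<^sub>R z))
        \<le> norm (k z * (2 * (LINT x|lborel. norm (g x))))"
      using L1_modulus_le[OF g] L1_modulus_nonneg[of g] k(2)
      by (intro AE_I2) (auto simp: abs_mult intro!: mult_left_mono)
  qed (intro integrable_mult_left k)
  have h: "integrable (lborel \<Otimes>\<^sub>M lborel) (case_prod h)"
  proof (rule lborel_pair.Fubini_integrable)
    show "case_prod h \<in> borel_measurable (lborel \<Otimes>\<^sub>M lborel)"
      unfolding h_def by measurable
    show "integrable lborel (\<lambda>z. LINT x|lborel. norm (case_prod h (z, x)))"
      using kN by (simp add: norm_h)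
    show "AE z in lborel. integrable lborel (\<lambda>x. case_prod h (z, x))"
      using integrable_translate[OF g] g by (auto simp: h_def)
  qed
  have hx: "integrable lborel (\<lambda>x. LINT z|lborel. h z x)"
    by (rule lborel_pair.integrable_snd[OF h])
  have eq: "AE x in lborel. (LINT z|lborel. h z x) = (LINT z|lborel. k z *\<^sub>R g (x - r *\<^sub>R z)) - g x"
    using lborel_pair.AE_integrable_snd[OF h]
  proof eventually_elim
    case (elim x)
    have kg: "integrable lborel (\<lambda>z. k z *\<^sub>R g x)" using k by simp
    have "(\<lambda>z. k z *\<^sub>R g (x - r *\<^sub>R z)) = (\<lambda>z. h z x + k z *\<^sub>R g x)"
      by (simp add: h_def scaleR_diff_right)
    with elim kg k show ?case by (simp add: integral_scaleR_left)
  qed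
  have m [measurable]: "(\<lambda>x. LINT z|lborel. k z *\<^sub>R g (x - r *\<^sub>R z)) \<in> borel_measurable lborel"
    by (intro lborel.borel_measurable_lebesgue_integral) measurable
  have "integrable lborel (\<lambda>x. (LINT z|lborel. h z x) + g x)" using hx g by simp
  then show "integrable lborel (\<lambda>x. LINT z|lborel. k z *\<^sub>R g (x - r *\<^sub>R z))"
    by (rule integrable_cong_AE_imp) (use eq in auto)
  have "(LINT x|lborel. norm ((LINT z|lborel. k z *\<^sub>R g (x - r *\<^sub>R z)) - g x))
      = (LINT x|lborel. norm (LINT z|lborel. h z x))"
    using eq hx by (intro integral_cong_AE) auto
  also have "\<dots> \<le> (LINT x|lborel. LINT z|lborel. norm (h z x))"
  proof (rule integral_mono)
    have "integrable (lborel \<Otimes>\<^sub>M lborel) (\<lambda>(z, x). norm (h z x))"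
      using integrable_norm[OF h] by (simp add: case_prod_unfold)
    then show "integrable lborel (\<lambda>x. LINT z|lborel. norm (h z x))"
      by (rule lborel_pair.integrable_snd)
  qed (use hx integral_norm_bound in auto)
  also have "\<dots> = (LINT z|lborel. LINT x|lborel. norm (h z x))"
    using integrable_norm[OF h] by (intro lborel_pair.Fubini_integral) (simp add: case_prod_unfold)
  finally show "(LINT x|lborel. norm ((LINT z|lborel. k z *\<^sub>R g (x - r *\<^sub>R z)) - g x))
           \<le> (LINT z|lborel. k z * L1_modulus g (r *\<^sub>R z))"
    by (simp add: norm_h)
qed

section \<open>The Fourier transform of the Gaussian\<close>

definition gauss :: "'a::euclidean_space \<Rightarrow> real" where
  "gauss x = exp (- (norm x)\<^sup>2 / 2)"

lemma gauss_pos: "gauss x > 0" and gauss_le_1: "gauss x \<le> 1"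
  by (simp_all add: gauss_def)

lemma gauss_borel [measurable]: "gauss \<in> borel_measurable borel"
  unfolding gauss_def by measurable

text \<open>
  The one-dimensional case is the characteristic function of the standard normal distribution.
\<close>
lemma has_bochner_integral_gauss_1:
  "has_bochner_integral lborel (\<lambda>x::real. complex_of_real (exp (- x\<^sup>2 / 2)) * cis (x * b))
     (complex_of_real (sqrt (2 * pi) * exp (- b\<^sup>2 / 2)))"
proof -
  let ?g = "\<lambda>x::real. complex_of_real (exp (- x\<^sup>2 / 2)) * cis (x * b)"
  have "integrable lborel (\<lambda>x. sqrt (2 * pi) * std_normal_density x)"
    by (intro integrable_mult_right) simp
  then have "integrable lborel (\<lambda>x::real. exp (- x\<^sup>2 / 2))"
    by (simp add: std_normal_density_def)
  then have I: "integrable lborel ?g"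
    by (rule Bochner_Integration.integrable_bound) (auto simp: norm_mult)
  have "complex_of_real (exp (- b\<^sup>2 / 2)) = (CLINT x|std_normal_distribution. iexp (b * x))"
    using char_std_normal_distribution unfolding char_def by metis
  also have "\<dots> = (CLINT x|lborel. std_normal_density x *\<^sub>R iexp (b * x))"
    by (rule integral_density) (auto simp: normal_density_nonneg)
  also have "\<dots> = (CLINT x|lborel. complex_of_real (1 / sqrt (2 * pi)) * ?g x)"
    by (intro Bochner_Integration.integral_cong)
      (simp_all add: std_normal_density_def cis_conv_exp scaleR_conv_of_real mult_ac)
  also have "\<dots> = complex_of_real (1 / sqrt (2 * pi)) * integral\<^sup>L lborel ?g"
    by simp
  finally have "integral\<^sup>L lborel ?g = complex_of_real (sqrt (2 * pi) * exp (- b\<^sup>2 / 2))"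
    by (simp add: field_simps flip: of_real_mult)
  with I show ?thesis by (simp add: has_bochner_integral_iff)
qed

text \<open>
  Fubini along the coordinate axes: Lebesgue measure on a Euclidean space is a product measure over
  its basis. It lets the Gaussian transform factor into one-dimensional ones.
\<close>
lemma has_bochner_integral_lborel_prod:
  fixes h :: "'a::euclidean_space \<Rightarrow> real \<Rightarrow> complex"
  assumes h: "\<And>b. b \<in> Basis \<Longrightarrow> has_bochner_integral lborel (h b) (I b)"
  shows "has_bochner_integral lborel (\<lambda>x. \<Prod>b\<in>Basis. h b (x \<bullet> b)) (\<Prod>b\<in>Basis. I b)"
proof -
  interpret product_sigma_finite "\<lambda>_::'a. lborel :: real measure" by standard
  have int: "integrable lborel (h b)" and val: "integral\<^sup>L lborel (h b) = I b" if "b \<in> Basis" for b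
    using h[OF that] by (simp_all add: has_bochner_integral_iff)
  have m: "h b \<in> borel_measurable borel" if "b \<in> Basis" for b using int[OF that] by auto
  have "has_bochner_integral (\<Pi>\<^sub>M b\<in>Basis. lborel) (\<lambda>x. \<Prod>b\<in>Basis. h b (x b)) (\<Prod>b\<in>Basis. I b)"
    using product_integrable_prod[of Basis h] product_integral_prod[of Basis h] int val
    by (simp add: has_bochner_integral_iff)
  moreover have "(\<Prod>b'\<in>Basis. h b' ((\<Sum>b\<in>Basis. x b *\<^sub>R b) \<bullet> b')) = (\<Prod>b\<in>Basis. h b (x b))"
    for x :: "'a \<Rightarrow> real"
    by (intro prod.cong) simp_all
  moreover have "(\<lambda>x. \<Prod>b\<in>Basis. h b (x \<bullet> b)) \<in> borel_measurable borel"
    using m by (intro borel_measurable_prod) (auto intro: measurable_compose[OF _ m])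
  moreover have "(\<lambda>f. \<Sum>b\<in>Basis. f b *\<^sub>R b) \<in> measurable (\<Pi>\<^sub>M b\<in>Basis. lborel) (borel :: 'a measure)"
    by measurable
  ultimately show ?thesis
    by (subst lborel_eq) (simp add: has_bochner_integral_distr)
qed

lemma has_bochner_integral_gauss:
  fixes w :: "'a::euclidean_space"
  shows "has_bochner_integral lborel (\<lambda>x. complex_of_real (gauss x) * cis (x \<bullet> w))
     (complex_of_real ((2 * pi) powr (real DIM('a) / 2) * gauss w))"
proof -
  have *: "complex_of_real (gauss x) * cis (x \<bullet> w) =
      (\<Prod>b\<in>Basis. complex_of_real (exp (- (x \<bullet> b)\<^sup>2 / 2)) * cis ((x \<bullet> b) * (w \<bullet> b)))" for x :: 'a
  proof -
    have "complex_of_real (gauss x) = (\<Prod>b\<in>Basis. complex_of_real (exp (- (x \<bullet> b)\<^sup>2 / 2)))"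
      unfolding gauss_def power2_norm_eq_inner euclidean_inner[of x x]
      by (simp add: exp_sum sum_negf[symmetric] sum_divide_distrib power2_eq_square flip: of_real_prod)
    moreover have "cis (x \<bullet> w) = (\<Prod>b\<in>Basis. cis ((x \<bullet> b) * (w \<bullet> b)))"
      unfolding euclidean_inner[of x w]
      by (simp add: cis_conv_exp sum_distrib_left exp_sum)
    ultimately show ?thesis by (simp add: prod.distrib)
  qed
  have **: "complex_of_real ((2 * pi) powr (real DIM('a) / 2) * gauss w) =
      (\<Prod>b\<in>Basis. complex_of_real (sqrt (2 * pi) * exp (- (w \<bullet> b)\<^sup>2 / 2)))"
  proof -
    have "(2 * pi) powr (real DIM('a) / 2) = sqrt (2 * pi) ^ DIM('a)"
      by (simp add: powr_half_sqrt[symmetric] powr_powr flip: powr_realpow)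
    moreover have "gauss w = (\<Prod>b\<in>Basis. exp (- (w \<bullet> b)\<^sup>2 / 2))"
      unfolding gauss_def power2_norm_eq_inner euclidean_inner[of w w]
      by (simp add: exp_sum sum_negf[symmetric] sum_divide_distrib power2_eq_square)
    ultimately show ?thesis by (simp add: prod.distrib flip: of_real_prod)
  qed
  show ?thesis unfolding * **
    by (rule has_bochner_integral_lborel_prod[OF has_bochner_integral_gauss_1])
qed

section \<open>Fourier inversion\<close>

definition fourier_norm :: "'a::euclidean_space itself \<Rightarrow> real" where
  "fourier_norm _ = (2 * pi) powr (- (real DIM('a) / 2))"

lemma fourier_norm_pos: "fourier_norm TYPE('a::euclidean_space) > 0"
  by (simp add: fourier_norm_def)

lemma fourier_eq_cis:
  fixes g :: "'a::euclidean_space \<Rightarrow> complex"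
  shows "fourier g w = complex_of_real (fourier_norm TYPE('a)) * (LINT x|lborel. g x * cis (- (w \<bullet> x)))"
  by (simp add: fourier_def fourier_norm_def cis_conv_exp)

lemma integrable_mult_cis:
  fixes g :: "'a::euclidean_space \<Rightarrow> complex"
  assumes "integrable lborel g" and "h \<in> borel_measurable borel"
  shows "integrable lborel (\<lambda>x. g x * cis (h x))"
proof -
  have [measurable]: "g \<in> borel_measurable borel" "h \<in> borel_measurable borel" using assms by auto
  show ?thesis by (rule Bochner_Integration.integrable_bound[OF assms(1)]) (auto simp: norm_mult)
qed

lemma integral_gauss: "integrable (lborel :: 'a::euclidean_space measure) gauss"
  "fourier_norm TYPE('a) * integral\<^sup>L lborel (gauss :: 'a \<Rightarrow> real) = 1"
proof -
  have "has_bochner_integral lborel (\<lambda>x::'a. complex_of_real (gauss x))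
     (complex_of_real ((2 * pi) powr (real DIM('a) / 2)))"
    using has_bochner_integral_gauss[of "0::'a"] by (simp add: gauss_def)
  then have "integrable lborel (\<lambda>x::'a. complex_of_real (gauss x))"
     "integral\<^sup>L lborel (\<lambda>x::'a. complex_of_real (gauss x)) = complex_of_real ((2 * pi) powr (real DIM('a) / 2))"
    by (simp_all add: has_bochner_integral_iff)
  then show "integrable (lborel :: 'a measure) gauss"
    "fourier_norm TYPE('a) * integral\<^sup>L lborel (gauss :: 'a \<Rightarrow> real) = 1"
    by (simp_all add: complex_of_real_integrable_eq fourier_norm_def powr_minus field_simps)
qed

text \<open>
  Inversion with a Gaussian cut-off is exact: inserting the definition of the transform and exchanging
  the integrals leaves the transform of a Gaussian of width $1/t$, which is a Gaussian of width $t$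
  centred at $x$. The substitutions $w = z/t$ and $u = x - tz$ make the powers of $t$ cancel.
\<close>
lemma gauss_average_eq_fourier:
  fixes f :: "'a::euclidean_space \<Rightarrow> complex"
  assumes f: "integrable lborel f" and t: "t > 0"
  shows "complex_of_real (fourier_norm TYPE('a)) * (LINT w|lborel. fourier f w * (complex_of_real (gauss (t *\<^sub>R w)) * cis (w \<bullet> x)))
    = (LINT z|lborel. (fourier_norm TYPE('a) * gauss z) *\<^sub>R f (x - t *\<^sub>R z))"
proof -
  let ?c = "fourier_norm TYPE('a)" and ?d = "DIM('a)"
  have [measurable]: "f \<in> borel_measurable borel" using f by auto
  have gt: "integrable lborel (\<lambda>w::'a. gauss (t *\<^sub>R w))"
    using integrable_affine[OF integral_gauss(1), of t 0] t by simp
  define h where "h u w = f u * (complex_of_real (gauss (t *\<^sub>R w)) * cis (w \<bullet> (x - u)))" for u w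
  have norm_h: "norm (h u w) = norm (f u) * gauss (t *\<^sub>R w)" for u w
    using gauss_pos[of "t *\<^sub>R w"] by (simp add: h_def norm_mult)
  have h: "integrable (lborel \<Otimes>\<^sub>M lborel) (case_prod h)"
  proof (rule lborel_pair.Fubini_integrable)
    show "case_prod h \<in> borel_measurable (lborel \<Otimes>\<^sub>M lborel)"
      unfolding h_def by measurable
    show "integrable lborel (\<lambda>u. LINT w|lborel. norm (case_prod h (u, w)))"
      using f by (simp add: norm_h)
    have "integrable lborel (h u)" for u
      unfolding h_def using gt by (intro integrable_mult_right integrable_mult_cis) auto
    then show "AE u in lborel. integrable lborel (\<lambda>w. case_prod h (u, w))"
      by simp
  qed
  have inner: "complex_of_real ?c * (LINT w|lborel. h u w) = f u * complex_of_real ((1 / t) ^ ?d * gauss ((1 / t) *\<^sub>R (x - u)))" for u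
  proof -
    let ?F = "\<lambda>w. complex_of_real (gauss (t *\<^sub>R w)) * cis (w \<bullet> (x - u))"
    have "integral\<^sup>L lborel ?F = \<bar>1 / t\<bar> ^ ?d *\<^sub>R (LINT z|lborel. ?F (0 + (1 / t) *\<^sub>R z))"
      using t by (intro integral_affine) measurable
    also have "\<dots> = (1 / t) ^ ?d *\<^sub>R (LINT z|lborel. complex_of_real (gauss z) * cis (z \<bullet> ((1 / t) *\<^sub>R (x - u))))"
      using t by simp
    also have "\<dots> = (1 / t) ^ ?d *\<^sub>R complex_of_real ((2 * pi) powr (real ?d / 2) * gauss ((1 / t) *\<^sub>R (x - u)))"
      using has_bochner_integral_gauss[of "(1 / t) *\<^sub>R (x - u)"] by (simp only: has_bochner_integral_iff)
    finally have "complex_of_real ?c * integral\<^sup>L lborel ?F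
        = complex_of_real ((?c * (2 * pi) powr (real ?d / 2)) * ((1 / t) ^ ?d * gauss ((1 / t) *\<^sub>R (x - u))))"
      by (simp add: scaleR_conv_of_real mult_ac)
    moreover have "?c * (2 * pi) powr (real ?d / 2) = 1"
      by (simp add: fourier_norm_def powr_minus)
    ultimately show ?thesis unfolding h_def by (simp add: mult.left_commute)
  qed
  have "(LINT w|lborel. fourier f w * (complex_of_real (gauss (t *\<^sub>R w)) * cis (w \<bullet> x)))
      = (LINT w|lborel. complex_of_real ?c * (LINT u|lborel. h u w))"
  proof (rule Bochner_Integration.integral_cong[OF refl])
    fix w
    have "fourier f w * (complex_of_real (gauss (t *\<^sub>R w)) * cis (w \<bullet> x))
        = complex_of_real ?c * ((LINT u|lborel. f u * cis (- (w \<bullet> u))) * (complex_of_real (gauss (t *\<^sub>R w)) * cis (w \<bullet> x)))"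
      by (simp add: fourier_eq_cis)
    also have "(LINT u|lborel. f u * cis (- (w \<bullet> u))) * (complex_of_real (gauss (t *\<^sub>R w)) * cis (w \<bullet> x))
        = (LINT u|lborel. f u * cis (- (w \<bullet> u)) * (complex_of_real (gauss (t *\<^sub>R w)) * cis (w \<bullet> x)))"
      by simp
    also have "\<dots> = (LINT u|lborel. h u w)"
    proof (rule Bochner_Integration.integral_cong[OF refl])
      fix u
      have "cis (w \<bullet> (x - u)) = cis (- (w \<bullet> u)) * cis (w \<bullet> x)"
        by (simp add: cis_mult inner_diff_right)
      then show "f u * cis (- (w \<bullet> u)) * (complex_of_real (gauss (t *\<^sub>R w)) * cis (w \<bullet> x)) = h u w"
        by (simp add: h_def)
    qed
    finally show "fourier f w * (complex_of_real (gauss (t *\<^sub>R w)) * cis (w \<bullet> x))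
        = complex_of_real ?c * (LINT u|lborel. h u w)" .
  qed
  also have "\<dots> = complex_of_real ?c * (LINT u|lborel. LINT w|lborel. h u w)"
    using lborel_pair.Fubini_integral[OF h] by simp
  also have "\<dots> = (LINT u|lborel. f u * complex_of_real ((1 / t) ^ ?d * gauss ((1 / t) *\<^sub>R (x - u))))"
    unfolding inner[symmetric] by (rule integral_mult_right_zero[symmetric])
  also have "\<dots> = \<bar>- t\<bar> ^ ?d *\<^sub>R (LINT z|lborel. f (x + (- t) *\<^sub>R z) * complex_of_real ((1 / t) ^ ?d * gauss ((1 / t) *\<^sub>R (x - (x + (- t) *\<^sub>R z)))))"
    using t by (intro integral_affine) measurable
  also have "\<dots> = (LINT z|lborel. t ^ ?d *\<^sub>R (f (x - t *\<^sub>R z) * complex_of_real ((1 / t) ^ ?d * gauss z)))"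
    using t by simp
  also have "\<dots> = (LINT z|lborel. gauss z *\<^sub>R f (x - t *\<^sub>R z))"
    using t by (intro Bochner_Integration.integral_cong) (simp_all add: scaleR_conv_of_real power_divide)
  finally show ?thesis
    by (simp add: scaleR_conv_of_real mult.assoc)
qed

text \<open>
  Let $t \to 0$ in the preceding identity. The cut-off side tends pointwise to the inversion integral,
  since the transform is integrable; the average side tends to $f$ in $L^1$, hence almost everywhere
  along a subsequence.
\<close>
theorem fourier_inversion:
  fixes f :: "'a::euclidean_space \<Rightarrow> complex"
  assumes f: "integrable lborel f" and f_hat: "integrable lborel (fourier f)"
  shows "AE x in lborel. f x = complex_of_real (fourier_norm TYPE('a)) * (LINT w|lborel. fourier f w * cis (w \<bullet> x))"
proof -
  let ?c = "fourier_norm TYPE('a)"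
  define t where "t n = 1 / real (Suc n)" for n
  have t: "t n > 0" for n by (simp add: t_def)
  have t0: "t \<longlonglongrightarrow> 0" unfolding t_def by (rule LIMSEQ_Suc[OF lim_1_over_n])
  define A where "A n x = (LINT z|lborel. (?c * gauss z) *\<^sub>R f (x - t n *\<^sub>R z))" for n x
  have k: "integrable lborel (\<lambda>z::'a. ?c * gauss z)" "\<And>z::'a. 0 \<le> ?c * gauss z" "(LINT z::'a|lborel. ?c * gauss z) = 1"
    using integral_gauss[where 'a='a] by (simp_all add: less_imp_le fourier_norm_pos gauss_pos)
  have conv: "integrable lborel (A n)"
    "(LINT x|lborel. norm (A n x - f x)) \<le> (LINT z|lborel. ?c * gauss z * L1_modulus f (t n *\<^sub>R z))" for n
    using convolution_L1_error[OF k f, of "t n"] unfolding A_def by auto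
  have kN: "(\<lambda>n. LINT z|lborel. ?c * gauss z * L1_modulus f (t n *\<^sub>R z)) \<longlonglongrightarrow> (LINT z|(lborel::'a measure). 0)"
  proof (rule integral_dominated_convergence[where w = "\<lambda>z. ?c * gauss z * (2 * (LINT x|lborel. norm (f x)))"])
    show "AE z in lborel. (\<lambda>n. ?c * gauss z * L1_modulus f (t n *\<^sub>R z)) \<longlonglongrightarrow> 0"
    proof (rule AE_I2)
      fix z :: 'a
      have "(\<lambda>n. t n *\<^sub>R z) \<longlonglongrightarrow> 0" using tendsto_scaleR[OF t0 tendsto_const, of z] by simp
      from L1_modulus_tendsto_sequentially[OF f this]
      show "(\<lambda>n. ?c * gauss z * L1_modulus f (t n *\<^sub>R z)) \<longlonglongrightarrow> 0"
        by (rule tendsto_mult_right_zero)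
    qed
    show "AE z in lborel. norm (?c * gauss z * L1_modulus f (t n *\<^sub>R z))
        \<le> ?c * gauss z * (2 * (LINT x|lborel. norm (f x)))" for n
    proof (rule AE_I2)
      fix z :: 'a
      have "norm (?c * gauss z * L1_modulus f (t n *\<^sub>R z)) = ?c * gauss z * L1_modulus f (t n *\<^sub>R z)"
        using k(2)[of z] L1_modulus_nonneg[of f "t n *\<^sub>R z"] by (simp only: real_norm_def abs_of_nonneg mult_nonneg_nonneg)
      also have "\<dots> \<le> ?c * gauss z * (2 * (LINT x|lborel. norm (f x)))"
        by (rule mult_left_mono[OF L1_modulus_le[OF f] k(2)])
      finally show "norm (?c * gauss z * L1_modulus f (t n *\<^sub>R z))
        \<le> ?c * gauss z * (2 * (LINT x|lborel. norm (f x)))" .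
    qed
    show "(\<lambda>z. ?c * gauss z * L1_modulus f (t n *\<^sub>R z)) \<in> borel_measurable lborel" for n
      using borel_measurable_L1_modulus[OF f] by measurable
  qed (use k(1) in auto)
  have "(\<lambda>n. LINT x|lborel. norm (A n x - f x)) \<longlonglongrightarrow> 0"
    by (rule tendsto_sandwich[OF _ _ tendsto_const kN[simplified]]) (use conv(2) in auto)
  from tendsto_L1_AE_subseq[OF _ this] conv(1) f obtain r where r: "strict_mono r"
    and AE: "AE x in lborel. (\<lambda>n. A (r n) x - f x) \<longlonglongrightarrow> 0"
    by auto
  have lim: "(\<lambda>n. A n x) \<longlonglongrightarrow> complex_of_real ?c * (LINT w|lborel. fourier f w * cis (w \<bullet> x))" for x
  proof -
    have [measurable]: "fourier f \<in> borel_measurable borel" using f_hat by auto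
    have "(\<lambda>n. LINT w|lborel. fourier f w * (complex_of_real (gauss (t n *\<^sub>R w)) * cis (w \<bullet> x)))
        \<longlonglongrightarrow> (LINT w|lborel. fourier f w * cis (w \<bullet> x))"
    proof (rule integral_dominated_convergence[where w = "\<lambda>w. norm (fourier f w)"])
      show "AE w in lborel. (\<lambda>n. fourier f w * (complex_of_real (gauss (t n *\<^sub>R w)) * cis (w \<bullet> x)))
          \<longlonglongrightarrow> fourier f w * cis (w \<bullet> x)"
      proof (rule AE_I2)
        fix w :: 'a
        have "(\<lambda>n. fourier f w * (complex_of_real (exp (- (norm (t n *\<^sub>R w))\<^sup>2 / 2)) * cis (w \<bullet> x)))
          \<longlonglongrightarrow> fourier f w * (complex_of_real (exp (- (norm (0 *\<^sub>R w))\<^sup>2 / 2)) * cis (w \<bullet> x))"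
          by (intro tendsto_intros t0) simp
        then show "(\<lambda>n. fourier f w * (complex_of_real (gauss (t n *\<^sub>R w)) * cis (w \<bullet> x)))
          \<longlonglongrightarrow> fourier f w * cis (w \<bullet> x)"
          by (simp add: gauss_def)
      qed
      show "AE w in lborel. norm (fourier f w * (complex_of_real (gauss (t n *\<^sub>R w)) * cis (w \<bullet> x)))
          \<le> norm (fourier f w)" for n
        by (intro AE_I2) (simp add: norm_mult gauss_pos gauss_le_1 abs_of_pos mult_left_le)
    qed (use f_hat in auto)
    then show ?thesis
      unfolding A_def gauss_average_eq_fourier[OF f t, symmetric] by (rule tendsto_mult_left)
  qed
  show ?thesis
    using AE
  proof eventually_elim
    case (elim x)
    then have "(\<lambda>n. A (r n) x) \<longlonglongrightarrow> f x" by (simp add: LIM_zero_cancel)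
    then show ?case
      using LIMSEQ_subseq_LIMSEQ[OF lim r, of x] LIMSEQ_unique by (auto simp: comp_def)
  qed
qed

section \<open>From characters to continuous test functions\<close>

text \<open>
  An inductive closure rather than explicit finite sums: closure under products and convergence along
  such functions then follow by induction from the monomials.
\<close>
inductive trig_sum :: "('a::euclidean_space \<Rightarrow> complex) \<Rightarrow> bool" where
  monomial: "trig_sum (\<lambda>w. a * cis (w \<bullet> x))"
| add: "trig_sum g \<Longrightarrow> trig_sum h \<Longrightarrow> trig_sum (\<lambda>w. g w + h w)"

lemma trig_sum_const: "trig_sum (\<lambda>w. a)"
  using trig_sum.monomial[of a 0] by simp

lemma trig_sum_continuous: "trig_sum g \<Longrightarrow> continuous_on S g"
  by (induction rule: trig_sum.induct) (intro continuous_intros | assumption)+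

lemma trig_sum_mult:
  assumes "trig_sum g" "trig_sum h"
  shows "trig_sum (\<lambda>w. g w * h w)"
  using assms(1)
proof (induction rule: trig_sum.induct)
  case (monomial a x)
  show ?case using assms(2)
  proof (induction rule: trig_sum.induct)
    case (monomial b y)
    have "(\<lambda>w. a * cis (w \<bullet> x) * (b * cis (w \<bullet> y))) = (\<lambda>w. (a * b) * cis (w \<bullet> (x + y)))"
      by (simp add: inner_add_right cis_mult[symmetric] mult_ac)
    then show ?case by (simp only: trig_sum.monomial)
  next
    case (add g h)
    then show ?case using trig_sum.add[OF add.IH] by (simp add: distrib_left)
  qed
next
  case (add g k)
  then show ?case using trig_sum.add[OF add.IH] by (simp add: distrib_right)
qed

text \<open>
  These real trigonometric sums separate points $w \ne v$: with $x = (w - v)/|w - v|^2$ the function takes the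
  values $\cos 1$ at $w$ and $\cos 0$ at $v$.
\<close>
lemma trig_sum_cos: "trig_sum (\<lambda>w. complex_of_real (cos ((w - v) \<bullet> x)))"
proof -
  have "(\<lambda>w. complex_of_real (cos ((w - v) \<bullet> x)))
      = (\<lambda>w. (cis (- (v \<bullet> x)) / 2) * cis (w \<bullet> x) + (cis (v \<bullet> x) / 2) * cis (w \<bullet> (- x)))"
    by (rule ext) (simp add: complex_eq_iff inner_diff_left cos_diff field_simps)
  then show ?thesis by (simp only: trig_sum.intros)
qed

lemma trig_sum_uniformly_dense:
  fixes S :: "'a::euclidean_space set" and g :: "'a \<Rightarrow> real"
  assumes S: "compact S" and g: "continuous_on S g" and e: "e > 0"
  shows "\<exists>h. trig_sum (\<lambda>w. complex_of_real (h w)) \<and> (\<forall>w\<in>S. \<bar>g w - h w\<bar> < e)"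
proof -
  interpret function_ring_on "{h. trig_sum (\<lambda>w. complex_of_real (h w))}" S
  proof unfold_locales
    fix h :: "'a \<Rightarrow> real" assume "h \<in> {h. trig_sum (\<lambda>w. complex_of_real (h w))}"
    then have "continuous_on S (\<lambda>w. Re (complex_of_real (h w)))"
      using trig_sum_continuous continuous_on_Re by blast
    then show "continuous_on S h" by simp
  next
    fix w v :: 'a assume wv: "w \<noteq> v"
    define x where "x = (w - v) /\<^sub>R ((w - v) \<bullet> (w - v))"
    have "(w - v) \<bullet> x = 1" using wv by (simp add: x_def)
    moreover have "cos (1 :: real) \<noteq> 1"
      using cos_monotone_0_pi[of 0 1] pi_gt3 by simp
    ultimately have "cos ((w - v) \<bullet> x) \<noteq> cos ((v - v) \<bullet> x)" by simp
    then show "\<exists>h\<in>{h. trig_sum (\<lambda>w. complex_of_real (h w))}. h w \<noteq> h v"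
      using trig_sum_cos[of v x] by (intro bexI[of _ "\<lambda>w. cos ((w - v) \<bullet> x)"]) auto
  qed (use S trig_sum.add trig_sum_mult trig_sum_const in \<open>auto simp: of_real_add of_real_mult\<close>)
  show ?thesis using Stone_Weierstrass_basic[OF g e] by blast
qed

text \<open>
  An analogue of Levy's continuity theorem for complex measures on a compact set with uniformly bounded
  total variation. On the compact set the test function is uniformly close to a trigonometric sum, for
  which convergence is the hypothesis; the bound on the total variation makes the error uniform in $K$.
\<close>
lemma weak_convergence_from_characters:
  fixes g :: "'a::euclidean_space \<Rightarrow> real" and \<zeta> :: "nat \<Rightarrow> nat \<Rightarrow> complex" and \<nu> :: "'a \<Rightarrow> complex"
  assumes S: "compact S" and g: "continuous_on UNIV g"
    and \<omega>: "\<And>k. k \<ge> 1 \<Longrightarrow> \<omega> k \<in> S" and C: "\<And>K. (\<Sum>k=1..K. norm (\<zeta> K k)) \<le> C"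
    and \<nu>: "integrable lborel \<nu>" "\<And>w. w \<notin> S \<Longrightarrow> \<nu> w = 0"
    and lim: "\<And>x. (\<lambda>K. \<Sum>k=1..K. \<zeta> K k * cis (\<omega> k \<bullet> x)) \<longlonglongrightarrow> (LINT w|lborel. \<nu> w * cis (w \<bullet> x))"
  shows "(\<lambda>K. \<Sum>k=1..K. \<zeta> K k * complex_of_real (g (\<omega> k))) \<longlonglongrightarrow> (LINT w|lborel. \<nu> w * complex_of_real (g w))"
proof -
  have [measurable]: "\<nu> \<in> borel_measurable borel" using \<nu> by auto
  have bint: "integrable lborel (\<lambda>w. \<nu> w * h w)" if "continuous_on UNIV h" for h :: "'a \<Rightarrow> complex"
  proof -
    have [measurable]: "h \<in> borel_measurable borel" by (rule borel_measurable_continuous_onI[OF that])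
    have "bounded (h ` S)"
      using compact_continuous_image[OF continuous_on_subset[OF that] S] compact_imp_bounded by blast
    then obtain B where B: "\<And>w. w \<in> S \<Longrightarrow> norm (h w) \<le> B" by (auto simp: bounded_iff)
    have le: "norm (\<nu> w * h w) \<le> norm (B * norm (\<nu> w))" for w
    proof (cases "w \<in> S")
      case True
      then have "norm (\<nu> w) * norm (h w) \<le> norm (\<nu> w) * \<bar>B\<bar>"
        using B[OF True] by (intro mult_left_mono) auto
      then show ?thesis by (simp add: norm_mult abs_mult mult.commute)
    qed (simp add: \<nu>)
    show ?thesis
    proof (rule Bochner_Integration.integrable_bound)
      show "integrable lborel (\<lambda>w. B * norm (\<nu> w))" using \<nu>(1) by simp
    qed (use le in simp_all)
  qed
  have trig: "(\<lambda>K. \<Sum>k=1..K. \<zeta> K k * h (\<omega> k)) \<longlonglongrightarrow> (LINT w|lborel. \<nu> w * h w)" if "trig_sum h" for h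
    using that
  proof (induction rule: trig_sum.induct)
    case (monomial a x)
    show ?case using tendsto_mult_left[OF lim[of x], of a]
      by (simp add: sum_distrib_left mult_ac flip: integral_mult_right_zero)
  next
    case (add g h)
    show ?case
      using tendsto_add[OF add.IH] bint[OF trig_sum_continuous[OF add.hyps(1)]] bint[OF trig_sum_continuous[OF add.hyps(2)]]
      by (simp add: distrib_left sum.distrib)
  qed
  have C0: "0 \<le> C" using C[of 0] by simp
  \<comment> \<open>a bound for the total mass of both measures together, with $1$ added to make it positive\<close>
  define D where "D = C + (LINT w|lborel. norm (\<nu> w)) + 1"
  have D: "D > 0" using C0 by (simp add: D_def add_nonneg_pos)
  show ?thesis
  proof (rule LIMSEQ_I)
    fix e :: real assume e: "e > 0"
    define d where "d = e / (2 * D)"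
    have d: "d > 0" using e D by (simp add: d_def)
    from trig_sum_uniformly_dense[OF S continuous_on_subset[OF g] d] obtain h where
      h: "trig_sum (\<lambda>w. complex_of_real (h w))" and gh: "\<And>w. w \<in> S \<Longrightarrow> \<bar>g w - h w\<bar> < d" by auto
    let ?g = "\<lambda>w. complex_of_real (g w)" and ?h = "\<lambda>w. complex_of_real (h w)"
    have gh': "norm (?g w - ?h w) \<le> d" if "w \<in> S" for w
      using gh[OF that] by (simp flip: of_real_diff)
    have sums: "norm ((\<Sum>k=1..K. \<zeta> K k * ?g (\<omega> k)) - (\<Sum>k=1..K. \<zeta> K k * ?h (\<omega> k))) \<le> C * d" for K
    proof -
      have "norm ((\<Sum>k=1..K. \<zeta> K k * ?g (\<omega> k)) - (\<Sum>k=1..K. \<zeta> K k * ?h (\<omega> k)))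
          = norm (\<Sum>k=1..K. \<zeta> K k * (?g (\<omega> k) - ?h (\<omega> k)))"
        by (simp add: sum_subtractf right_diff_distrib)
      also have "\<dots> \<le> (\<Sum>k=1..K. norm (\<zeta> K k) * d)"
        using gh' \<omega> by (intro sum_norm_le) (auto simp: norm_mult intro!: mult_left_mono simp del: of_real_diff)
      also have "\<dots> \<le> C * d"
        using C[of K] d by (simp add: sum_distrib_right[symmetric] mult_right_mono)
      finally show ?thesis .
    qed
    have gc: "integrable lborel (\<lambda>w. \<nu> w * ?g w)" "integrable lborel (\<lambda>w. \<nu> w * ?h w)"
      using bint[OF trig_sum_continuous[OF h]] bint[of ?g] g by (auto intro!: continuous_intros)
    have ints: "norm ((LINT w|lborel. \<nu> w * ?g w) - (LINT w|lborel. \<nu> w * ?h w)) \<le> (LINT w|lborel. norm (\<nu> w)) * d"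
    proof -
      have "(LINT w|lborel. \<nu> w * ?g w) - (LINT w|lborel. \<nu> w * ?h w) = (LINT w|lborel. \<nu> w * ?g w - \<nu> w * ?h w)"
        using gc by simp
      also have "norm \<dots> \<le> (LINT w|lborel. norm (\<nu> w * ?g w - \<nu> w * ?h w))"
        by (rule integral_norm_bound)
      also have "\<dots> \<le> (LINT w|lborel. norm (\<nu> w) * d)"
      proof (rule integral_mono)
        show "norm (\<nu> w * ?g w - \<nu> w * ?h w) \<le> norm (\<nu> w) * d" for w
          using gh'[of w] \<nu>(2)[of w]
          by (cases "w \<in> S") (auto simp: norm_mult simp flip: right_diff_distrib intro!: mult_left_mono)
      qed (use gc \<nu> in auto)
      finally show ?thesis by simp
    qed
    from LIMSEQ_D[OF trig[OF h], of "e / 2"] e obtain no where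
      no: "\<And>K. K \<ge> no \<Longrightarrow> norm ((\<Sum>k=1..K. \<zeta> K k * ?h (\<omega> k)) - (LINT w|lborel. \<nu> w * ?h w)) < e / 2" by auto
    show "\<exists>no. \<forall>K\<ge>no. norm ((\<Sum>k=1..K. \<zeta> K k * ?g (\<omega> k)) - (LINT w|lborel. \<nu> w * ?g w)) < e"
    proof (intro exI allI impI)
      fix K assume "K \<ge> no"
      let ?a = "\<Sum>k=1..K. \<zeta> K k * ?g (\<omega> k)" and ?b = "\<Sum>k=1..K. \<zeta> K k * ?h (\<omega> k)"
      let ?c = "LINT w|lborel. \<nu> w * ?h w" and ?d = "LINT w|lborel. \<nu> w * ?g w"
      have "norm (?a - ?d) \<le> norm (?a - ?b) + norm (?b - ?c) + norm (?d - ?c)"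
        using norm_triangle_ineq[of "?a - ?b" "?b - ?c"] norm_triangle_ineq4[of "?a - ?c" "?d - ?c"] by simp
      also have "\<dots> < C * d + e / 2 + (LINT w|lborel. norm (\<nu> w)) * d"
        using sums[of K] ints no[OF \<open>K \<ge> no\<close>] by linarith
      also have "\<dots> = (D - 1) * d + e / 2" by (simp add: D_def algebra_simps)
      also have "\<dots> \<le> D * d + e / 2" using d by simp
      also have "\<dots> = e" using D by (simp add: d_def)
      finally show "norm (?a - ?d) < e" .
    qed
  qed
qed

section \<open>The energy argument\<close>

lemma norm_cis_diff_le: "norm (cis a - cis b) \<le> \<bar>a - b\<bar>"
proof -
  have "norm (cis (a - b) - 1) \<le> \<bar>a - b\<bar>"
    using iexp_approx1[of "a - b" 0] by (simp add: cis_conv_exp)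
  moreover have "cis a - cis b = cis b * (cis (a - b) - 1)"
    by (simp add: algebra_simps cis_mult)
  ultimately show ?thesis by (simp add: norm_mult)
qed

lemma borel_measurable_cnj [measurable]:
  "f \<in> borel_measurable M \<Longrightarrow> (\<lambda>x. cnj (f x)) \<in> borel_measurable M"
  by (rule borel_measurable_continuous_on[OF continuous_on_cnj[OF continuous_on_id]])

text \<open>
  The deterministic situation after Fourier inversion: weights $\zeta$ at points $\omega$ satisfy a
  regularised discrete version of the convolution equation
  $r * Z = r * \nu$ on $S$, where $r(w) = \int\rho(x)\,e^{-iw\cdot x}\,dx$.
  The right-hand side of the equation is written with the transform of $\nu$, in which form it arises
  from data $f\rho$. Dividing the normal equations by $c = (2\pi)^{-d/2}$ turns $\lambda$ into
  $\mu = \lambda / c$.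
\<close>
locale discrete_deconvolution =
  fixes \<rho> :: "'a::euclidean_space \<Rightarrow> real" and S :: "'a set" and \<nu> :: "'a \<Rightarrow> complex"
    and \<omega> :: "nat \<Rightarrow> 'a" and \<zeta> :: "nat \<Rightarrow> nat \<Rightarrow> complex" and \<mu> C :: real
  assumes rho_int: "integrable lborel \<rho>" and rho_nonneg: "\<And>x. 0 \<le> \<rho> x" and rho_supp: "supp \<rho> = UNIV"
    and nu_int: "integrable lborel \<nu>" and nu_S: "\<And>w. w \<notin> S \<Longrightarrow> \<nu> w = 0"
    and S: "compact S" and omega_S: "\<And>k. k \<ge> 1 \<Longrightarrow> \<omega> k \<in> S" and omega_dense: "S \<subseteq> closure (\<omega> ` {1..})"
    and mu: "0 \<le> \<mu>"
    and zeta_bound: "\<And>K. (\<Sum>k=1..K. norm (\<zeta> K k)) \<le> C"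
    and zeta_vanish: "\<And>l. l \<ge> 1 \<Longrightarrow> (\<lambda>K. \<zeta> K l) \<longlonglongrightarrow> 0"
    and normal: "\<And>K l. l \<in> {1..K} \<Longrightarrow>
      (\<Sum>k=1..K. (LINT x|lborel. complex_of_real (\<rho> x) * cis (- ((\<omega> l - \<omega> k) \<bullet> x))) * \<zeta> K k)
        + complex_of_real \<mu> * \<zeta> K l
      = (LINT x|lborel. complex_of_real (\<rho> x) * (LINT w|lborel. \<nu> w * cis (w \<bullet> x)) * cis (- (\<omega> l \<bullet> x)))"
begin

text \<open>
  Up to a constant factor, \<open>u K\<close> and \<open>v\<close> are the inverse Fourier transforms of the discrete measure
  with weights \<open>\<zeta> K\<close> and of $\nu$.
\<close>
definition u :: "nat \<Rightarrow> 'a \<Rightarrow> complex" where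
  "u K x = (\<Sum>k=1..K. \<zeta> K k * cis (\<omega> k \<bullet> x))"

definition v :: "'a \<Rightarrow> complex" where
  "v x = (LINT w|lborel. \<nu> w * cis (w \<bullet> x))"

definition residual :: "nat \<Rightarrow> 'a \<Rightarrow> complex" where
  "residual K w = (LINT x|lborel. complex_of_real (\<rho> x) * (u K x - v x) * cis (- (w \<bullet> x)))"

definition total_mass :: real where
  "total_mass = C + (LINT w|lborel. norm (\<nu> w))"

lemma measurable_data [measurable]: "\<rho> \<in> borel_measurable borel" "\<nu> \<in> borel_measurable borel"
  using rho_int nu_int by auto

lemma measurable_u [measurable]: "u K \<in> borel_measurable borel"
  unfolding u_def by measurable

lemma measurable_v [measurable]: "v \<in> borel_measurable borel"
  unfolding v_def by measurable

lemma norm_u_le: "norm (u K x) \<le> C"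
proof -
  have "norm (u K x) \<le> (\<Sum>k=1..K. norm (\<zeta> K k))"
    unfolding u_def by (intro sum_norm_le) (simp add: norm_mult)
  then show ?thesis using zeta_bound[of K] by simp
qed

lemma norm_v_le: "norm (v x) \<le> (LINT w|lborel. norm (\<nu> w))"
  unfolding v_def by (rule order_trans[OF integral_norm_bound]) (simp add: norm_mult)

lemma norm_diff_le: "norm (u K x - v x) \<le> total_mass"
  using norm_triangle_ineq4[of "u K x" "v x"] norm_u_le[of K x] norm_v_le[of x] by (simp add: total_mass_def)

lemma total_mass_nonneg: "0 \<le> total_mass"
  using norm_diff_le[of 0 0] norm_ge_zero order_trans by blast

lemma integrable_rho_times:
  assumes [measurable]: "h \<in> borel_measurable borel" and b: "\<And>x. norm (h x) \<le> b"
  shows "integrable lborel (\<lambda>x. complex_of_real (\<rho> x) * h x)"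
proof (rule Bochner_Integration.integrable_bound)
  show "integrable lborel (\<lambda>x. b * \<rho> x)" using rho_int by simp
  have "norm (complex_of_real (\<rho> x) * h x) \<le> norm (b * \<rho> x)" for x
    using mult_right_mono[OF order_trans[OF b abs_ge_self] rho_nonneg, of x x] rho_nonneg[of x]
    by (simp add: norm_mult abs_mult mult.commute)
  then show "AE x in lborel. norm (complex_of_real (\<rho> x) * h x) \<le> norm (b * \<rho> x)" by simp
qed simp

text \<open>
  This is the normal equation, read in terms of $u - v$.
\<close>
lemma residual_at_sample:
  assumes l: "l \<in> {1..K}"
  shows "residual K (\<omega> l) = - complex_of_real \<mu> * \<zeta> K l"
proof -
  let ?r = "\<lambda>x. complex_of_real (\<rho> x)" and ?e = "\<lambda>x. cis (- (\<omega> l \<bullet> x))"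
  have int1: "integrable lborel (\<lambda>x. ?r x * (\<zeta> K k * cis (- ((\<omega> l - \<omega> k) \<bullet> x))))" for k
    by (rule integrable_rho_times[where b = "norm (\<zeta> K k)"]) (simp_all add: norm_mult)
  have int2: "integrable lborel (\<lambda>x. ?r x * (v x * ?e x))"
    by (rule integrable_rho_times[where b = "LINT w|lborel. norm (\<nu> w)"]) (simp_all add: norm_mult norm_v_le)
  have int3: "integrable lborel (\<lambda>x. ?r x * (u K x * ?e x))"
    by (rule integrable_rho_times[where b = C]) (simp_all add: norm_mult norm_u_le)
  have "u K x * ?e x = (\<Sum>k=1..K. \<zeta> K k * cis (- ((\<omega> l - \<omega> k) \<bullet> x)))" for x
    unfolding u_def sum_distrib_right
    by (intro sum.cong refl) (simp add: mult.assoc cis_mult inner_diff_left)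
  then have "(LINT x|lborel. ?r x * (u K x * ?e x))
      = (\<Sum>k=1..K. LINT x|lborel. ?r x * (\<zeta> K k * cis (- ((\<omega> l - \<omega> k) \<bullet> x))))"
    using int1 by (simp add: sum_distrib_left)
  also have "\<dots> = (\<Sum>k=1..K. (LINT x|lborel. ?r x * cis (- ((\<omega> l - \<omega> k) \<bullet> x))) * \<zeta> K k)"
    by (intro sum.cong refl) (simp add: mult_ac flip: integral_mult_left_zero integral_mult_right_zero)
  also have "\<dots> = (LINT x|lborel. ?r x * (v x * ?e x)) - complex_of_real \<mu> * \<zeta> K l"
    using normal[OF l] by (simp add: v_def mult.assoc algebra_simps)
  finally show ?thesis
    using int2 int3 by (simp add: residual_def left_diff_distrib right_diff_distrib mult.assoc)
qed

lemma norm_residual_le: "norm (residual K w) \<le> total_mass * (LINT x|lborel. \<rho> x)"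
proof -
  have "norm (residual K w) \<le> (LINT x|lborel. norm (complex_of_real (\<rho> x) * ((u K x - v x) * cis (- (w \<bullet> x)))))"
    unfolding residual_def mult.assoc by (rule integral_norm_bound)
  also have "\<dots> \<le> (LINT x|lborel. total_mass * \<rho> x)"
  proof (rule integral_mono)
    show "integrable lborel (\<lambda>x. norm (complex_of_real (\<rho> x) * ((u K x - v x) * cis (- (w \<bullet> x)))))"
      by (intro integrable_norm integrable_rho_times[where b = total_mass]) (simp_all add: norm_mult norm_diff_le)
    show "norm (complex_of_real (\<rho> x) * ((u K x - v x) * cis (- (w \<bullet> x)))) \<le> total_mass * \<rho> x" for x
      using mult_left_mono[OF norm_diff_le rho_nonneg, of x K x] rho_nonneg[of x]
      by (simp add: norm_mult mult.commute)
  qed (use rho_int in simp)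
  finally show ?thesis by simp
qed

text \<open>
  The residuals are equicontinuous, since $u - v$ is bounded uniformly in $K$ and
  $\int\rho\,|e^{-iw\cdot x} - e^{-iy\cdot x}|\,dx \to 0$ as $y \to w$. So it suffices to look at samples
  $\omega_l$ near $w$, and there the residual is $-\mu\zeta_l$, which vanishes in the limit.
\<close>
lemma residual_tendsto_0:
  assumes w: "w \<in> S"
  shows "(\<lambda>K. residual K w) \<longlonglongrightarrow> 0"
proof (rule LIMSEQ_I)
  fix e :: real assume e: "e > 0"
  define m where "m y = (LINT x|lborel. \<rho> x * norm (cis (- (w \<bullet> x)) - cis (- (y \<bullet> x))))" for y
  have equicont: "norm (residual K w - residual K y) \<le> total_mass * m y" for K y
  proof -
    let ?h = "\<lambda>x. complex_of_real (\<rho> x) * ((u K x - v x) * (cis (- (w \<bullet> x)) - cis (- (y \<bullet> x))))"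
    have int: "integrable lborel (\<lambda>x. complex_of_real (\<rho> x) * ((u K x - v x) * cis (- (z \<bullet> x))))" for z
      by (rule integrable_rho_times[where b = total_mass]) (simp_all add: norm_mult norm_diff_le)
    have "residual K w - residual K y = (LINT x|lborel. ?h x)"
      unfolding residual_def mult.assoc
      by (subst Bochner_Integration.integral_diff[symmetric]) (use int in \<open>simp_all add: right_diff_distrib\<close>)
    also have "norm \<dots> \<le> (LINT x|lborel. norm (?h x))" by (rule integral_norm_bound)
    also have "\<dots> \<le> (LINT x|lborel. total_mass * (\<rho> x * norm (cis (- (w \<bullet> x)) - cis (- (y \<bullet> x)))))"
    proof (rule integral_mono)
      show "integrable lborel (\<lambda>x. norm (?h x))"
        using integrable_norm[OF Bochner_Integration.integrable_diff[OF int[of w] int[of y]]]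
        by (simp add: right_diff_distrib)
      have "integrable lborel (\<lambda>x. norm (complex_of_real (\<rho> x) * (cis (- (w \<bullet> x)) - cis (- (y \<bullet> x)))))"
        by (intro integrable_norm integrable_rho_times[where b = 2] order_trans[OF norm_triangle_ineq4]) simp_all
      then show "integrable lborel (\<lambda>x. total_mass * (\<rho> x * norm (cis (- (w \<bullet> x)) - cis (- (y \<bullet> x)))))"
        by (simp add: norm_mult rho_nonneg)
      show "norm (?h x) \<le> total_mass * (\<rho> x * norm (cis (- (w \<bullet> x)) - cis (- (y \<bullet> x))))" for x
        using mult_right_mono[OF norm_diff_le, of "\<rho> x * norm (cis (- (w \<bullet> x)) - cis (- (y \<bullet> x)))" K x] rho_nonneg[of x]
        by (simp add: norm_mult mult_ac)
    qed
    finally show ?thesis by (simp add: m_def)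
  qed
  obtain y where y: "\<And>n. y n \<in> \<omega> ` {1..}" "y \<longlonglongrightarrow> w"
    using omega_dense w closure_sequential by blast
  have "(\<lambda>n. m (y n)) \<longlonglongrightarrow> (LINT x|(lborel::'a measure). 0)"
    unfolding m_def
  proof (rule integral_dominated_convergence[where w = "\<lambda>x. \<rho> x * 2"])
    show "AE x in lborel. (\<lambda>n. \<rho> x * norm (cis (- (w \<bullet> x)) - cis (- (y n \<bullet> x)))) \<longlonglongrightarrow> 0"
    proof (rule AE_I2)
      fix x
      have "(\<lambda>n. \<rho> x * norm (cis (- (w \<bullet> x)) - cis (- (y n \<bullet> x))))
          \<longlonglongrightarrow> \<rho> x * norm (cis (- (w \<bullet> x)) - cis (- (w \<bullet> x)))"
        by (intro tendsto_intros y(2))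
      then show "(\<lambda>n. \<rho> x * norm (cis (- (w \<bullet> x)) - cis (- (y n \<bullet> x)))) \<longlonglongrightarrow> 0" by simp
    qed
    have "norm (cis a - cis b) \<le> 2" for a b using norm_triangle_ineq4[of "cis a" "cis b"] by simp
    then show "AE x in lborel. norm (\<rho> x * norm (cis (- (w \<bullet> x)) - cis (- (y n \<bullet> x)))) \<le> \<rho> x * 2" for n
      using rho_nonneg by (intro AE_I2) (simp add: abs_mult mult_left_mono)
  qed (use rho_int in simp_all)
  then have "(\<lambda>n. total_mass * m (y n)) \<longlonglongrightarrow> 0" by (simp add: tendsto_mult_right_zero)
  from LIMSEQ_D[OF this, of "e / 2"] e obtain n where "norm (total_mass * m (y n) - 0) < e / 2" by auto
  then have n: "total_mass * m (y n) < e / 2" by simp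
  from y(1)[of n] obtain l where l: "y n = \<omega> l" "l \<ge> 1" by auto
  have "(\<lambda>K. - complex_of_real \<mu> * \<zeta> K l) \<longlonglongrightarrow> 0"
    by (rule tendsto_mult_right_zero[OF zeta_vanish[OF l(2)]])
  from LIMSEQ_D[OF this, of "e / 2"] e obtain no where
    no: "\<And>K. K \<ge> no \<Longrightarrow> norm (- complex_of_real \<mu> * \<zeta> K l) < e / 2" by auto
  show "\<exists>no. \<forall>K\<ge>no. norm (residual K w - 0) < e"
  proof (intro exI allI impI)
    \<comment> \<open>the equation at the sample with index $l$ is available only for $K \ge l$\<close>
    fix K assume K: "K \<ge> max no l"
    have "norm (residual K w) \<le> norm (residual K w - residual K (\<omega> l)) + norm (residual K (\<omega> l))"
      using norm_triangle_ineq[of "residual K w - residual K (\<omega> l)" "residual K (\<omega> l)"] by simp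
    also have "\<dots> < e / 2 + e / 2"
      using equicont[of K "\<omega> l"] n no[of K] K l residual_at_sample[of l K] by (intro add_le_less_mono) auto
    finally show "norm (residual K w - 0) < e" by simp
  qed
qed

definition energy :: "nat \<Rightarrow> real" where
  "energy K = (LINT x|lborel. \<rho> x * (norm (u K x - v x))\<^sup>2)"

lemma energy_integrable: "integrable lborel (\<lambda>x. \<rho> x * (norm (u K x - v x))\<^sup>2)"
proof -
  have "integrable lborel (\<lambda>x. norm (complex_of_real (\<rho> x) * complex_of_real ((norm (u K x - v x))\<^sup>2)))"
    using norm_diff_le by (intro integrable_norm integrable_rho_times[where b = "total_mass\<^sup>2"]) (simp_all add: power_mono norm_power)
  then show ?thesis using rho_nonneg by (simp add: norm_mult norm_power)
qed

text \<open>
  One factor $u - v$ is kept and the conjugate of the other is expanded into characters: $\bar u$ into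
  those at the samples, where the residual is known, and $\bar v$ into those weighted by $\bar\nu$.
\<close>
lemma energy_eq:
  "complex_of_real (energy K) = - complex_of_real (\<mu> * (\<Sum>k=1..K. (norm (\<zeta> K k))\<^sup>2))
      - (LINT w|lborel. cnj (\<nu> w) * residual K w)"
proof -
  let ?r = "\<lambda>x. complex_of_real (\<rho> x)"
  have int: "integrable lborel (\<lambda>x. ?r x * ((u K x - v x) * cis (- (w \<bullet> x))))" for w
    by (rule integrable_rho_times[where b = total_mass]) (simp_all add: norm_mult norm_diff_le)
  have intu: "integrable lborel (\<lambda>x. ?r x * ((u K x - v x) * cnj (u K x)))"
    using norm_diff_le norm_u_le total_mass_nonneg
    by (intro integrable_rho_times[where b = "total_mass * C"]) (simp_all add: norm_mult mult_mono)
  have intv: "integrable lborel (\<lambda>x. ?r x * ((u K x - v x) * cnj (v x)))"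
    using norm_diff_le norm_v_le total_mass_nonneg
    by (intro integrable_rho_times[where b = "total_mass * (LINT w|lborel. norm (\<nu> w))"]) (simp_all add: norm_mult mult_mono)
  have "complex_of_real (energy K) = (LINT x|lborel. ?r x * ((u K x - v x) * cnj (u K x - v x)))"
    unfolding energy_def integral_complex_of_real[symmetric] complex_norm_square[symmetric] by simp
  also have "\<dots> = (LINT x|lborel. ?r x * ((u K x - v x) * cnj (u K x))) - (LINT x|lborel. ?r x * ((u K x - v x) * cnj (v x)))"
    using intu intv by (subst Bochner_Integration.integral_diff[symmetric]) (simp_all add: right_diff_distrib)
  also have "(LINT x|lborel. ?r x * ((u K x - v x) * cnj (u K x))) = - complex_of_real (\<mu> * (\<Sum>k=1..K. (norm (\<zeta> K k))\<^sup>2))"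
  proof -
    have "(LINT x|lborel. ?r x * ((u K x - v x) * cnj (u K x)))
        = (LINT x|lborel. (\<Sum>k=1..K. cnj (\<zeta> K k) * (?r x * ((u K x - v x) * cis (- (\<omega> k \<bullet> x))))))"
      by (intro Bochner_Integration.integral_cong refl, subst (2) u_def) (simp add: sum_distrib_left cis_cnj mult_ac)
    also have "\<dots> = (\<Sum>k=1..K. cnj (\<zeta> K k) * residual K (\<omega> k))"
      using int by (simp add: residual_def mult.assoc)
    also have "\<dots> = (\<Sum>k=1..K. - complex_of_real (\<mu> * (norm (\<zeta> K k))\<^sup>2))"
    proof (intro sum.cong refl)
      fix k assume "k \<in> {1..K}"
      then show "cnj (\<zeta> K k) * residual K (\<omega> k) = - complex_of_real (\<mu> * (norm (\<zeta> K k))\<^sup>2)"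
        using complex_norm_square[of "\<zeta> K k"] by (simp add: residual_at_sample mult_ac)
    qed
    finally show ?thesis by (simp add: sum_negf sum_distrib_left)
  qed
  also have "(LINT x|lborel. ?r x * ((u K x - v x) * cnj (v x))) = (LINT w|lborel. cnj (\<nu> w) * residual K w)"
  proof -
    define h where "h x w = cnj (\<nu> w) * (?r x * ((u K x - v x) * cis (- (w \<bullet> x))))" for x w
    have norm_h: "norm (h x w) = norm (\<nu> w) * (\<rho> x * norm (u K x - v x))" for x w
      using rho_nonneg[of x] by (simp add: h_def norm_mult)
    have h: "integrable (lborel \<Otimes>\<^sub>M lborel) (case_prod h)"
    proof (rule lborel_pair.Fubini_integrable)
      show "case_prod h \<in> borel_measurable (lborel \<Otimes>\<^sub>M lborel)"
        unfolding h_def by measurable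
      have "integrable lborel (\<lambda>x. \<rho> x * norm (u K x - v x))"
        using integrable_norm[OF int[of 0]] rho_nonneg by (simp add: norm_mult)
      then show "integrable lborel (\<lambda>x. LINT w|lborel. norm (case_prod h (x, w)))"
        by (simp add: norm_h)
      have "integrable lborel (\<lambda>w. cnj (\<nu> w) * cis (- (w \<bullet> x)))" for x
        using nu_int by (intro integrable_mult_cis) auto
      moreover have "h x = (\<lambda>w. (?r x * (u K x - v x)) * (cnj (\<nu> w) * cis (- (w \<bullet> x))))" for x
        by (simp add: h_def fun_eq_iff)
      ultimately have "integrable lborel (h x)" for x
        by (simp del: integrable_mult_right_iff)
      then show "AE x in lborel. integrable lborel (\<lambda>w. case_prod h (x, w))" by simp
    qed
    have "?r x * ((u K x - v x) * cnj (v x)) = (LINT w|lborel. h x w)" for x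
    proof -
      have "cnj (v x) = (LINT w|lborel. cnj (\<nu> w) * cis (- (w \<bullet> x)))"
        unfolding v_def by (subst Bochner_Integration.integral_cnj[symmetric]) (simp add: cis_cnj)
      then have "?r x * ((u K x - v x) * cnj (v x)) = (?r x * (u K x - v x)) * (LINT w|lborel. cnj (\<nu> w) * cis (- (w \<bullet> x)))"
        by (simp add: mult.assoc)
      also have "\<dots> = (LINT w|lborel. (?r x * (u K x - v x)) * (cnj (\<nu> w) * cis (- (w \<bullet> x))))"
        by (rule integral_mult_right_zero[symmetric])
      also have "\<dots> = (LINT w|lborel. h x w)"
        by (simp add: h_def mult_ac)
      finally show ?thesis .
    qed
    then have "(LINT x|lborel. ?r x * ((u K x - v x) * cnj (v x))) = (LINT x|lborel. LINT w|lborel. h x w)"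
      by simp
    also have "\<dots> = (LINT w|lborel. LINT x|lborel. h x w)"
      using lborel_pair.Fubini_integral[OF h] by simp
    also have "\<dots> = (LINT w|lborel. cnj (\<nu> w) * residual K w)"
      by (simp add: h_def residual_def mult.assoc)
    finally show ?thesis .
  qed
  finally show ?thesis .
qed

text \<open>
  The regularisation term in the energy identity has the favourable sign, so only the integral of the
  residual against $\bar\nu$ matters; and $\nu$ lives on $S$, where the residual tends to $0$.
\<close>
lemma energy_tendsto_0: "energy \<longlonglongrightarrow> 0"
proof -
  have [measurable]: "residual K \<in> borel_measurable borel" for K
    unfolding residual_def by measurable
  have "(\<lambda>K. LINT w|lborel. cnj (\<nu> w) * residual K w) \<longlonglongrightarrow> (LINT w|(lborel::'a measure). 0)"
  proof (rule integral_dominated_convergence[where w = "\<lambda>w. norm (\<nu> w) * (total_mass * (LINT x|lborel. \<rho> x))"])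
    show "AE w in lborel. (\<lambda>K. cnj (\<nu> w) * residual K w) \<longlonglongrightarrow> 0"
    proof (rule AE_I2)
      fix w
      show "(\<lambda>K. cnj (\<nu> w) * residual K w) \<longlonglongrightarrow> 0"
        by (cases "w \<in> S") (simp_all add: residual_tendsto_0 tendsto_mult_right_zero nu_S)
    qed
    show "AE w in lborel. norm (cnj (\<nu> w) * residual K w) \<le> norm (\<nu> w) * (total_mass * (LINT x|lborel. \<rho> x))" for K
      by (intro AE_I2) (simp add: norm_mult mult_left_mono norm_residual_le)
    show "(\<lambda>w. cnj (\<nu> w) * residual K w) \<in> borel_measurable lborel" for K
      by measurable
  qed (use nu_int in simp_all)
  then have lim: "(\<lambda>K. norm (LINT w|lborel. cnj (\<nu> w) * residual K w)) \<longlonglongrightarrow> 0"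
    by (simp add: tendsto_norm_zero)
  have "energy K \<le> norm (LINT w|lborel. cnj (\<nu> w) * residual K w)" for K
  proof -
    have "energy K = - (\<mu> * (\<Sum>k=1..K. (norm (\<zeta> K k))\<^sup>2)) - Re (LINT w|lborel. cnj (\<nu> w) * residual K w)"
      using arg_cong[OF energy_eq[of K], of Re] by simp
    also have "\<dots> \<le> - Re (LINT w|lborel. cnj (\<nu> w) * residual K w)"
      using mu by (simp add: sum_nonneg)
    also have "\<dots> \<le> norm (LINT w|lborel. cnj (\<nu> w) * residual K w)"
      using abs_Re_le_cmod[of "LINT w|lborel. cnj (\<nu> w) * residual K w"] by linarith
    finally show ?thesis .
  qed
  moreover have "0 \<le> energy K" for K
    unfolding energy_def using rho_nonneg by simp
  ultimately show ?thesis
    by (intro tendsto_sandwich[OF _ _ tendsto_const lim]) auto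
qed

text \<open>
  Bernstein-type bound: all frequencies lie in the bounded set $S$, so total mass times a radius
  of $S$ is a Lipschitz constant, whatever $K$ is; $1$ is added to make it positive.
\<close>
lemma u_v_Lipschitz:
  obtains L where "L > 0" "\<And>K x y. norm ((u K x - v x) - (u K y - v y)) \<le> L * norm (x - y)"
proof -
  obtain R where R: "R > 0" "\<And>w. w \<in> S \<Longrightarrow> norm w \<le> R"
    using compact_imp_bounded[OF S] by (auto simp: bounded_pos)
  have cis: "norm (cis (w \<bullet> x) - cis (w \<bullet> y)) \<le> R * norm (x - y)" if "w \<in> S" for w x y
  proof -
    have "norm (cis (w \<bullet> x) - cis (w \<bullet> y)) \<le> \<bar>w \<bullet> (x - y)\<bar>"
      using norm_cis_diff_le[of "w \<bullet> x" "w \<bullet> y"] by (simp add: inner_diff_right)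
    also have "\<dots> \<le> norm w * norm (x - y)" by (rule Cauchy_Schwarz_ineq2)
    also have "\<dots> \<le> R * norm (x - y)" using R(2)[OF that] by (rule mult_right_mono) simp
    finally show ?thesis .
  qed
  have u: "norm (u K x - u K y) \<le> C * (R * norm (x - y))" for K x y
  proof -
    have "u K x - u K y = (\<Sum>k=1..K. \<zeta> K k * (cis (\<omega> k \<bullet> x) - cis (\<omega> k \<bullet> y)))"
      by (simp add: u_def sum_subtractf right_diff_distrib)
    also have "norm \<dots> \<le> (\<Sum>k=1..K. norm (\<zeta> K k) * (R * norm (x - y)))"
      using omega_S cis by (intro sum_norm_le) (auto simp: norm_mult intro!: mult_left_mono)
    also have "\<dots> = (\<Sum>k=1..K. norm (\<zeta> K k)) * (R * norm (x - y))"
      by (simp add: sum_distrib_right)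
    also have "\<dots> \<le> C * (R * norm (x - y))"
      using zeta_bound R by (intro mult_right_mono) auto
    finally show ?thesis .
  qed
  have v: "norm (v x - v y) \<le> (LINT w|lborel. norm (\<nu> w)) * (R * norm (x - y))" for x y
  proof -
    have int: "integrable lborel (\<lambda>w. \<nu> w * cis (w \<bullet> x))" for x
      using nu_int by (intro integrable_mult_cis) auto
    have "v x - v y = (LINT w|lborel. \<nu> w * (cis (w \<bullet> x) - cis (w \<bullet> y)))"
      using int by (simp add: v_def right_diff_distrib)
    also have "norm \<dots> \<le> (LINT w|lborel. norm (\<nu> w * (cis (w \<bullet> x) - cis (w \<bullet> y))))"
      by (rule integral_norm_bound)
    also have "\<dots> \<le> (LINT w|lborel. norm (\<nu> w) * (R * norm (x - y)))"
    proof (rule integral_mono)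
      show "integrable lborel (\<lambda>w. norm (\<nu> w * (cis (w \<bullet> x) - cis (w \<bullet> y))))"
        using int by (simp add: right_diff_distrib)
      show "norm (\<nu> w * (cis (w \<bullet> x) - cis (w \<bullet> y))) \<le> norm (\<nu> w) * (R * norm (x - y))" for w
        by (cases "w \<in> S") (auto simp: norm_mult nu_S intro!: mult_left_mono cis)
    qed (use nu_int in simp)
    finally show ?thesis by simp
  qed
  show ?thesis
  proof
    show "total_mass * R + 1 > 0" using total_mass_nonneg R by (simp add: add_nonneg_pos)
    fix K x y
    have "norm ((u K x - v x) - (u K y - v y)) \<le> norm (u K x - u K y) + norm (v x - v y)"
      using norm_triangle_ineq4[of "u K x - u K y" "v x - v y"] by (simp add: algebra_simps)
    also have "\<dots> \<le> total_mass * R * norm (x - y)"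
      using add_mono[OF u[of K x y] v[of x y]] by (simp add: total_mass_def algebra_simps)
    also have "\<dots> \<le> (total_mass * R + 1) * norm (x - y)" by (simp add: distrib_right)
    finally show "norm ((u K x - v x) - (u K y - v y)) \<le> (total_mass * R + 1) * norm (x - y)" .
  qed
qed

text \<open>
  If the integral were zero, $\rho$ would vanish almost everywhere on the ball, and its centre would lie
  outside the essential support of $\rho$.
\<close>
lemma rho_mass_ball:
  assumes r: "r > 0"
  shows "(LINT x|lborel. \<rho> x * indicator (ball y r) x) > 0"
proof -
  have int: "integrable lborel (\<lambda>x. \<rho> x * indicator (ball y r) x)"
    using rho_int by (intro integrable_real_mult_indicator) auto
  have nn: "0 \<le> (LINT x|lborel. \<rho> x * indicator (ball y r) x)"
    using rho_nonneg by simp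
  moreover have "(LINT x|lborel. \<rho> x * indicator (ball y r) x) \<noteq> 0"
  proof
    assume "(LINT x|lborel. \<rho> x * indicator (ball y r) x) = 0"
    then have "AE x in lborel. \<rho> x * indicator (ball y r) x = 0"
      using integral_nonneg_eq_0_iff_AE[OF int] rho_nonneg by simp
    then have "AE x in lborel. x \<in> ball y r \<longrightarrow> \<rho> x = 0"
      by eventually_elim auto
    moreover have "y \<in> supp \<rho>" using rho_supp by simp
    moreover have "open (ball y r)" "y \<in> ball y r" using r by auto
    ultimately show False unfolding supp_def by blast
  qed
  ultimately show ?thesis by simp
qed

text \<open>
  If $|u - v| \ge e$ at $x$, then by the Lipschitz bound $|u - v| \ge e/2$ on a ball around $x$ whose
  radius does not depend on $K$. That costs at least $(e/2)^2$ times the mass of this ball in energy.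
\<close>
theorem characters_converge:
  "(\<lambda>K. \<Sum>k=1..K. \<zeta> K k * cis (\<omega> k \<bullet> x)) \<longlonglongrightarrow> (LINT w|lborel. \<nu> w * cis (w \<bullet> x))"
proof -
  obtain L where L: "L > 0" "\<And>K x y. norm ((u K x - v x) - (u K y - v y)) \<le> L * norm (x - y)"
    using u_v_Lipschitz by blast
  have "(\<lambda>K. u K x - v x) \<longlonglongrightarrow> 0"
  proof (rule LIMSEQ_I)
    fix e :: real assume e: "e > 0"
    \<comment> \<open>on the ball of this radius, $u - v$ varies by at most $e/2$\<close>
    define r where "r = e / (2 * L)"
    have r: "r > 0" using e L by (simp add: r_def)
    define m where "m = (LINT y|lborel. \<rho> y * indicator (ball x r) y)"
    have m: "m > 0" unfolding m_def by (rule rho_mass_ball[OF r])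
    have large: "(e / 2)\<^sup>2 * m \<le> energy K" if "e \<le> norm (u K x - v x)" for K
    proof -
      have "(e / 2)\<^sup>2 * m = (LINT y|lborel. (e / 2)\<^sup>2 * (\<rho> y * indicator (ball x r) y))"
        by (simp add: m_def)
      also have "\<dots> \<le> energy K"
        unfolding energy_def
      proof (rule integral_mono)
        show "integrable lborel (\<lambda>y. (e / 2)\<^sup>2 * (\<rho> y * indicator (ball x r) y))"
          using rho_int by (intro integrable_mult_right integrable_real_mult_indicator) auto
        show "(e / 2)\<^sup>2 * (\<rho> y * indicator (ball x r) y) \<le> \<rho> y * (norm (u K y - v y))\<^sup>2" for y
        proof (cases "y \<in> ball x r")
          case True
          then have "L * norm (x - y) \<le> e / 2"
            using L(1) by (simp add: r_def dist_norm field_simps)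
          then have "e / 2 \<le> norm (u K y - v y)"
            using L(2)[of K x y] that norm_triangle_ineq2[of "u K x - v x" "u K y - v y"] by linarith
          then have "(e / 2)\<^sup>2 \<le> (norm (u K y - v y))\<^sup>2"
            using e by (intro power_mono) auto
          then show ?thesis using True rho_nonneg[of y] by (simp add: mult.commute[of _ "\<rho> y"] mult_left_mono)
        next
          case False
          then show ?thesis using rho_nonneg[of y] by simp
        qed
      qed (rule energy_integrable)
      finally show ?thesis .
    qed
    have "(e / 2)\<^sup>2 * m > 0" using e m by simp
    from LIMSEQ_D[OF energy_tendsto_0 this] obtain no where
      no: "\<And>K. K \<ge> no \<Longrightarrow> energy K < (e / 2)\<^sup>2 * m" by fastforce
    show "\<exists>no. \<forall>K\<ge>no. norm (u K x - v x - 0) < e"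
      using large no by (intro exI[of _ no]) (force simp: not_less[symmetric])
  qed
  then show ?thesis
    unfolding u_def v_def by (rule LIM_zero_cancel)
qed

end

section \<open>Mollification\<close>

lemma tendsto_L1_dominated:
  fixes F :: "nat \<Rightarrow> 'a::euclidean_space \<Rightarrow> complex"
  assumes F [measurable]: "\<And>K. F K \<in> borel_measurable borel"
    and lim: "\<And>x. (\<lambda>K. F K x) \<longlonglongrightarrow> G x"
    and b: "integrable lborel b" "\<And>K x. norm (F K x) \<le> b x"
  shows "tendsto_L1 F G sequentially"
proof -
  have [measurable]: "G \<in> borel_measurable borel"
    using F lim by (rule borel_measurable_LIMSEQ_metric)
  have [measurable]: "b \<in> borel_measurable borel" using b(1) by auto
  have bG: "norm (G x) \<le> b x" for x
    using LIMSEQ_le_const2[OF tendsto_norm[OF lim[of x]]] b(2) by blast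
  have b0: "norm (b x) = b x" for x using order_trans[OF norm_ge_zero b(2)] by simp
  have "integrable lborel (F K)" for K
    by (rule Bochner_Integration.integrable_bound[OF b(1)]) (simp_all add: b b0[simplified])
  moreover have "integrable lborel G"
    by (rule Bochner_Integration.integrable_bound[OF b(1)]) (simp_all add: bG b0[simplified])
  moreover have "(\<lambda>K. LINT x|lborel. norm (F K x - G x)) \<longlonglongrightarrow> (LINT x|(lborel::'a measure). 0)"
  proof (rule integral_dominated_convergence[where w = "\<lambda>x. b x + b x"])
    show "AE x in lborel. (\<lambda>K. norm (F K x - G x)) \<longlonglongrightarrow> 0"
      using lim by (intro AE_I2 tendsto_norm_zero LIM_zero)
    have "norm (F K x - G x) \<le> b x + b x" for K x
      by (rule order_trans[OF norm_triangle_ineq4 add_mono[OF b(2) bG]])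
    then show "AE x in lborel. norm (norm (F K x - G x)) \<le> b x + b x" for K
      by simp
  qed (use b in simp_all)
  ultimately show ?thesis by (simp add: tendsto_L1_def)
qed

text \<open>
  The factors $1/K$, $p(\omega_k)$ and $K$, $1/p(\omega_k)$ cancel. For $K = 0$ both sides are $0$.
\<close>
lemma mollified_eq:
  assumes p: "\<And>k. k \<ge> 1 \<Longrightarrow> p (w k) \<noteq> 0" and \<phi>: "\<phi> \<in> borel_measurable borel"
  shows "mollified p w K \<zeta> \<phi> x = (\<Sum>k=1..K. \<zeta> k * complex_of_real (\<phi> (x - w k)))"
proof -
  have "(LINT w'|return borel (w k). \<phi> (x - w')) = \<phi> (x - w k)" for k
    using \<phi> by (intro integral_return) (auto intro: measurable_compose[OF _ \<phi>])
  then show ?thesis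
    unfolding mollified_def empirical_integral_def z_hat_def sum_distrib_left
    by (intro sum.cong refl) (auto simp: p)
qed

text \<open>
  For fixed $x$ the mollified measure is the measure tested against $\phi(x - \cdot)$, so weak
  convergence gives a pointwise limit. All the functions live in one ball and are bounded by
  $C\sup|\phi|$ there, which upgrades it to $L^1$.
\<close>
lemma mollified_tendsto_L1:
  fixes \<phi> :: "'a::euclidean_space \<Rightarrow> real"
  assumes \<phi>: "continuous_on UNIV \<phi>" "\<And>x. norm x > e \<Longrightarrow> \<phi> x = 0"
    and p: "\<And>k. k \<ge> 1 \<Longrightarrow> p (w k) \<noteq> 0"
    and S: "bounded S" "\<And>k. k \<ge> 1 \<Longrightarrow> w k \<in> S"
    and C: "\<And>K. (\<Sum>k=1..K. norm (\<zeta> K k)) \<le> C"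
    and lim: "\<And>g. continuous_on UNIV g \<Longrightarrow>
      (\<lambda>K. \<Sum>k=1..K. \<zeta> K k * complex_of_real (g (w k))) \<longlonglongrightarrow> (LINT w|lborel. \<nu> w * complex_of_real (g w))"
  shows "tendsto_L1 (\<lambda>K. mollified p w K (\<zeta> K) \<phi>) (\<lambda>x. LINT w'|lborel. \<nu> w' * complex_of_real (\<phi> (x - w'))) sequentially"
proof -
  have [measurable]: "\<phi> \<in> borel_measurable borel" by (rule borel_measurable_continuous_onI[OF \<phi>(1)])
  have eq: "mollified p w K \<zeta> \<phi> x = (\<Sum>k=1..K. \<zeta> k * complex_of_real (\<phi> (x - w k)))" for K \<zeta> x
    by (rule mollified_eq) (simp_all add: p)
  have "bounded (\<phi> ` cball 0 e)"
    using compact_continuous_image[OF continuous_on_subset[OF \<phi>(1)]] compact_imp_bounded by (metis compact_cball subset_UNIV)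
  then obtain b where b: "\<And>x. norm x \<le> e \<Longrightarrow> \<bar>\<phi> x\<bar> \<le> b" by (force simp: bounded_iff)
  obtain R where R: "\<And>x. x \<in> S \<Longrightarrow> norm x \<le> R" using S(1) by (auto simp: bounded_iff)
  define A where "A = cball (0::'a) (R + e)"
  have \<phi>_le: "\<bar>\<phi> (x - w k)\<bar> \<le> \<bar>b\<bar> * indicator A x" if "k \<ge> 1" for k x
  proof (cases "norm (x - w k) \<le> e")
    case True
    then have "norm x \<le> R + e"
      using R[OF S(2)[OF that]] norm_triangle_sub[of x "w k"] by simp
    then show ?thesis using b[OF True] by (simp add: A_def)
  qed (use \<phi>(2) in simp)
  show ?thesis
  proof (rule tendsto_L1_dominated)
    show "mollified p w K (\<zeta> K) \<phi> \<in> borel_measurable borel" for K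
    proof -
      have "mollified p w K (\<zeta> K) \<phi> = (\<lambda>x. \<Sum>k=1..K. \<zeta> K k * complex_of_real (\<phi> (x - w k)))"
        by (rule ext) (rule eq)
      then show ?thesis by simp
    qed
    show "(\<lambda>K. mollified p w K (\<zeta> K) \<phi> x) \<longlonglongrightarrow> (LINT w'|lborel. \<nu> w' * complex_of_real (\<phi> (x - w')))" for x
    proof -
      have "continuous_on UNIV (\<lambda>w'. \<phi> (x - w'))"
        by (rule continuous_on_compose2[OF \<phi>(1)]) (auto intro: continuous_intros)
      from lim[OF this] show ?thesis unfolding eq .
    qed
    show "integrable lborel (\<lambda>x. C * (\<bar>b\<bar> * indicator A x))"
      unfolding A_def
      by (intro integrable_mult_right integrable_real_indicator emeasure_lborel_cball_finite) simp
    show "norm (mollified p w K (\<zeta> K) \<phi> x) \<le> C * (\<bar>b\<bar> * indicator A x)" for K x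
    proof -
      have "norm (mollified p w K (\<zeta> K) \<phi> x) \<le> (\<Sum>k=1..K. norm (\<zeta> K k) * (\<bar>b\<bar> * indicator A x))"
        unfolding eq by (intro sum_norm_le) (auto simp: norm_mult intro!: mult_left_mono \<phi>_le)
      also have "\<dots> \<le> C * (\<bar>b\<bar> * indicator A x)"
        unfolding sum_distrib_right[symmetric] by (intro mult_right_mono C) simp
      finally show ?thesis .
    qed
  qed
qed

text \<open>
  The substitution $z = x - w$ turns the mollification into a convolution with $\phi_\varepsilon$. Its
  error is an average of the $L^1$ modulus of $\nu$ over shifts of size at most $\varepsilon$, where the
  modulus is small.
\<close>
lemma approximate_identity_L1:
  fixes \<phi> :: "real \<Rightarrow> 'a::euclidean_space \<Rightarrow> real" and \<nu> :: "'a \<Rightarrow> complex"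
  assumes \<nu>: "integrable lborel \<nu>"
    and nonneg: "\<And>\<epsilon> w. \<epsilon> > 0 \<Longrightarrow> 0 \<le> \<phi> \<epsilon> w"
    and supp: "\<And>\<epsilon> w. \<epsilon> > 0 \<Longrightarrow> norm w > \<epsilon> \<Longrightarrow> \<phi> \<epsilon> w = 0"
    and int: "\<And>\<epsilon>. \<epsilon> > 0 \<Longrightarrow> (LINT w|lborel. \<phi> \<epsilon> w) = 1"
  shows "tendsto_L1 (\<lambda>\<epsilon> x. LINT w'|lborel. \<nu> w' * complex_of_real (\<phi> \<epsilon> (x - w'))) \<nu> (at_right 0)"
proof -
  let ?G = "\<lambda>\<epsilon> x. LINT w'|lborel. \<nu> w' * complex_of_real (\<phi> \<epsilon> (x - w'))"
  have \<phi>_int: "integrable lborel (\<phi> \<epsilon>)" if "\<epsilon> > 0" for \<epsilon>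
    using int[OF that] not_integrable_integral_eq by fastforce
  have G: "?G \<epsilon> x = (LINT z|lborel. \<phi> \<epsilon> z *\<^sub>R \<nu> (x - 1 *\<^sub>R z))" if "\<epsilon> > 0" for \<epsilon> x
  proof -
    have [measurable]: "\<phi> \<epsilon> \<in> borel_measurable borel" "\<nu> \<in> borel_measurable borel"
      using \<phi>_int[OF that] \<nu> by auto
    have "?G \<epsilon> x = \<bar>- 1\<bar> ^ DIM('a) *\<^sub>R (LINT z|lborel. \<nu> (x + (- 1) *\<^sub>R z) * complex_of_real (\<phi> \<epsilon> (x - (x + (- 1) *\<^sub>R z))))"
      by (rule integral_affine) simp_all
    then show ?thesis by (simp add: scaleR_conv_of_real mult.commute)
  qed
  have "((\<lambda>\<epsilon>. LINT x|lborel. norm (?G \<epsilon> x - \<nu> x)) \<longlongrightarrow> 0) (at_right 0)"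
  proof (rule tendstoI)
    fix e :: real assume e: "e > 0"
    from L1_modulus_tendsto_0[OF \<nu>] e have "\<forall>\<^sub>F y in nhds 0. dist (L1_modulus \<nu> y) 0 < e / 2"
      by (intro tendstoD) auto
    then obtain d where d: "d > 0" "\<And>y. dist y 0 < d \<Longrightarrow> dist (L1_modulus \<nu> y) 0 < e / 2"
      by (auto simp: eventually_nhds_metric)
    show "\<forall>\<^sub>F \<epsilon> in at_right 0. dist (LINT x|lborel. norm (?G \<epsilon> x - \<nu> x)) 0 < e"
    proof (rule eventually_at_rightI[OF _ d(1)])
      fix \<epsilon> :: real assume "\<epsilon> \<in> {0<..<d}"
      then have \<epsilon>: "\<epsilon> > 0" "\<epsilon> < d" by auto
      have le: "\<phi> \<epsilon> z * L1_modulus \<nu> (1 *\<^sub>R z) \<le> \<phi> \<epsilon> z * (e / 2)" for z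
      proof (cases "norm z \<le> \<epsilon>")
        case True
        then have "L1_modulus \<nu> z < e / 2" using d(2)[of z] \<epsilon> by simp
        then show ?thesis using nonneg[OF \<epsilon>(1), of z] by (intro mult_left_mono) auto
      qed (use supp \<epsilon> in simp)
      have "(LINT x|lborel. norm (?G \<epsilon> x - \<nu> x)) \<le> (LINT z|lborel. \<phi> \<epsilon> z * L1_modulus \<nu> (1 *\<^sub>R z))"
        unfolding G[OF \<epsilon>(1)] by (rule convolution_L1_error[OF \<phi>_int[OF \<epsilon>(1)] nonneg[OF \<epsilon>(1)] int[OF \<epsilon>(1)] \<nu>])
      also have "\<dots> \<le> (LINT z|lborel. \<phi> \<epsilon> z * (e / 2))"
        using \<phi>_int[OF \<epsilon>(1)] le e nonneg[OF \<epsilon>(1)] by (intro integral_mono') auto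
      also have "\<dots> = e / 2" by (simp add: int[OF \<epsilon>(1)])
      finally show "dist (LINT x|lborel. norm (?G \<epsilon> x - \<nu> x)) 0 < e" using e by simp
    qed
  qed
  moreover have "\<forall>\<^sub>F \<epsilon> in at_right 0. integrable lborel (?G \<epsilon>)"
  proof (rule eventually_at_rightI[of 0 1])
    fix \<epsilon> :: real assume "\<epsilon> \<in> {0<..<1}"
    then have \<epsilon>: "\<epsilon> > 0" by simp
    show "integrable lborel (?G \<epsilon>)"
      unfolding G[OF \<epsilon>] by (rule convolution_L1_error[OF \<phi>_int[OF \<epsilon>] nonneg[OF \<epsilon>] int[OF \<epsilon>] \<nu>])
  qed simp
  ultimately show ?thesis using \<nu> by (simp add: tendsto_L1_def)
qed

section \<open>Samples and normal equations\<close>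

lemma fourier_continuous:
  fixes g :: "'a::euclidean_space \<Rightarrow> complex"
  assumes g: "integrable lborel g"
  shows "continuous_on UNIV (fourier g)"
proof (rule continuous_at_imp_continuous_on, intro ballI)
  fix w :: 'a
  have [measurable]: "g \<in> borel_measurable borel" using g by auto
  have "(\<lambda>n. fourier g (y n)) \<longlonglongrightarrow> fourier g w" if y: "y \<longlonglongrightarrow> w" for y
    unfolding fourier_eq_cis
  proof (intro tendsto_mult_left integral_dominated_convergence[where w = "\<lambda>x. norm (g x)"])
    show "AE x in lborel. (\<lambda>n. g x * cis (- (y n \<bullet> x))) \<longlonglongrightarrow> g x * cis (- (w \<bullet> x))"
      by (intro AE_I2 tendsto_intros y)
  qed (use g in \<open>simp_all add: norm_mult\<close>)
  then show "isCont (fourier g) w"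
    by (simp add: continuous_at_sequentially comp_def)
qed

text \<open>
  A nonempty open set has positive measure, so for continuous functions the essential support contains
  every point where the function does not vanish. This turns the support conditions on $\hat f$ and
  $\phi_\varepsilon$, which are stated modulo null sets, into pointwise ones.
\<close>
lemma nonzero_imp_in_supp:
  fixes g :: "'a::euclidean_space \<Rightarrow> 'b::real_normed_vector"
  assumes g: "continuous_on UNIV g" and nz: "g w \<noteq> 0"
  shows "w \<in> supp g"
proof (rule ccontr)
  assume "w \<notin> supp g"
  then obtain U where U: "open U" "w \<in> U" "AE y in lborel. y \<in> U \<longrightarrow> g y = 0"
    by (auto simp: supp_def)
  have "open {y. g y \<noteq> 0}" using g by (intro open_Collect_neq) (auto intro: continuous_intros)
  then have "open (U \<inter> {y. g y \<noteq> 0})" using U(1) by (rule open_Int[rotated])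
  moreover have "w \<in> U \<inter> {y. g y \<noteq> 0}" using U nz by simp
  ultimately obtain r where r: "r > 0" "ball w r \<subseteq> U \<inter> {y. g y \<noteq> 0}"
    by (meson open_contains_ball)
  have "AE y in lborel. y \<notin> ball w r"
    using U(3) by eventually_elim (use r in blast)
  then have "ball w r \<in> null_sets lborel" by (subst AE_iff_null_sets) auto
  then have "measure lborel (ball w r) = 0" by (simp add: measure_eq_0_null_sets)
  then show False using content_ball_pos[OF r(1), of w] by simp
qed

text \<open>
  The set where $p$ vanishes is null for the distribution of each sample, and there are countably many
  samples.
\<close>
lemma samples_in_positive_density:
  fixes \<omega> :: "nat \<Rightarrow> 'w \<Rightarrow> 'a::euclidean_space"
  assumes "prob_space M" and p: "integrable lborel p" "\<And>x. 0 \<le> p x"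
    and D: "\<And>k. k \<ge> 1 \<Longrightarrow> distributed M lborel (\<omega> k) (\<lambda>x. ennreal (p x))"
  shows "AE s in M. \<forall>k\<ge>1. p (\<omega> k s) \<noteq> 0"
proof -
  interpret prob_space M by fact
  have [measurable]: "p \<in> borel_measurable borel" using p by auto
  have "AE s in M. p (\<omega> k s) \<noteq> 0" if "k \<ge> 1" for k
    by (subst distributed_AE2[OF D[OF that]]) auto
  then show ?thesis by (auto simp: AE_all_countable intro: AE_impI)
qed

text \<open>
  The limit is $\nu = c\hat f$ with $c = (2\pi)^{-d/2}$: its transform is $f$ by Fourier inversion, so
  the normal equations, divided by $c$, become the discrete convolution equation with datum $\nu$.
\<close>
lemma weak_convergence_of_normal_equations:
  fixes f \<rho> :: "'a::euclidean_space \<Rightarrow> real" and w :: "nat \<Rightarrow> 'a"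
  assumes f: "integrable lborel f" and f_hat: "integrable lborel (fourier (\<lambda>x. complex_of_real (f x)))"
    and lam: "0 \<le> lam" and rho: "prob_density \<rho>" and rho_supp: "supp \<rho> = UNIV"
    and S: "compact S" "closure (w ` {1..}) = S" "supp (fourier (\<lambda>x. complex_of_real (f x))) \<subseteq> S"
    and normal: "\<And>K. K \<ge> 1 \<Longrightarrow> normal_equations f \<rho> lam w K (\<zeta> K)"
    and C: "\<And>K. (\<Sum>k=1..K. norm (\<zeta> K k)) \<le> C"
    and vanish: "(\<lambda>K. Max ((\<lambda>k. norm (\<zeta> K k)) ` {1..K})) \<longlonglongrightarrow> 0"
    and g: "continuous_on UNIV g"
  shows "(\<lambda>K. \<Sum>k=1..K. \<zeta> K k * complex_of_real (g (w k)))
    \<longlonglongrightarrow> (LINT y|lborel. complex_of_real (fourier_norm TYPE('a)) * fourier (\<lambda>x. complex_of_real (f x)) y * complex_of_real (g y))"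
proof -
  let ?f = "\<lambda>x. complex_of_real (f x)" and ?c = "fourier_norm TYPE('a)"
  define \<nu> where "\<nu> y = complex_of_real ?c * fourier ?f y" for y
  have f': "integrable lborel ?f" using f by simp
  have [measurable]: "f \<in> borel_measurable borel" "\<rho> \<in> borel_measurable borel" "\<nu> \<in> borel_measurable borel"
    using f f_hat rho by (auto simp: prob_density_def \<nu>_def[abs_def] has_bochner_integral_iff)
  have \<nu>: "integrable lborel \<nu>" using f_hat by (simp add: \<nu>_def[abs_def])
  have \<nu>_S: "\<nu> y = 0" if "y \<notin> S" for y
    using nonzero_imp_in_supp[OF fourier_continuous[OF f'], of y] S(3) that by (auto simp: \<nu>_def)
  have w_S: "w k \<in> S" if "k \<ge> 1" for k
    using S(2) closure_subset[of "w ` {1..}"] that by auto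
  have inv: "AE x in lborel. ?f x = (LINT y|lborel. \<nu> y * cis (y \<bullet> x))"
    using fourier_inversion[OF f' f_hat] by (simp add: \<nu>_def mult.assoc)
  interpret discrete_deconvolution \<rho> S \<nu> w \<zeta> "lam / ?c" C
  proof
    show "integrable lborel \<rho>" "0 \<le> \<rho> x" for x
      using rho by (auto simp: prob_density_def has_bochner_integral_iff)
    show "S \<subseteq> closure (w ` {1..})" using S(2) by simp
    show "0 \<le> lam / ?c" using lam fourier_norm_pos[where 'a='a] by simp
    show "(\<lambda>K. \<zeta> K l) \<longlonglongrightarrow> 0" if l: "l \<ge> 1" for l
    proof (rule Lim_null_comparison[OF _ vanish])
      show "\<forall>\<^sub>F K in sequentially. norm (\<zeta> K l) \<le> Max ((\<lambda>k. norm (\<zeta> K k)) ` {1..K})"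
        using eventually_ge_at_top[of l] by eventually_elim (use l in auto)
    qed
    show "(\<Sum>k=1..K. (LINT x|lborel. complex_of_real (\<rho> x) * cis (- ((w l - w k) \<bullet> x))) * \<zeta> K k)
        + complex_of_real (lam / ?c) * \<zeta> K l
      = (LINT x|lborel. complex_of_real (\<rho> x) * (LINT y|lborel. \<nu> y * cis (y \<bullet> x)) * cis (- (w l \<bullet> x)))"
      (is "?lhs = ?rhs") if l: "l \<in> {1..K}" for K l
    proof -
      have K: "K \<ge> 1" using l by simp
      have "complex_of_real ?c * ?lhs
          = (\<Sum>k=1..K. fourier (\<lambda>x. complex_of_real (\<rho> x)) (w l - w k) * \<zeta> K k) + complex_of_real lam * \<zeta> K l"
        using fourier_norm_pos[where 'a='a] by (simp add: fourier_eq_cis distrib_left sum_distrib_left mult.assoc)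
      also have "\<dots> = fourier (\<lambda>x. complex_of_real (f x * \<rho> x)) (w l)"
        using normal[OF K] l by (auto simp: normal_equations_def)
      also have "\<dots> = complex_of_real ?c * (LINT x|lborel. complex_of_real (\<rho> x) * ?f x * cis (- (w l \<bullet> x)))"
        by (simp add: fourier_eq_cis mult_ac)
      also have "(LINT x|lborel. complex_of_real (\<rho> x) * ?f x * cis (- (w l \<bullet> x))) = ?rhs"
        by (rule integral_cong_AE) (use inv in auto)
      finally show ?thesis using fourier_norm_pos[where 'a='a] by simp
    qed
  qed (use rho_supp \<nu> \<nu>_S S(1) w_S C in auto)
  show ?thesis
    unfolding \<nu>_def[symmetric]
    by (rule weak_convergence_from_characters[OF S(1) g w_S C \<nu> \<nu>_S characters_converge])
qed

theorem proposition3p1: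
  fixes f \<rho> p :: "'a::euclidean_space \<Rightarrow> real"
    and lam :: real
    and M :: "'w measure"
    and \<omega> :: "nat \<Rightarrow> 'w \<Rightarrow> 'a"
    and \<U> :: "'a set"
    and \<phi> :: "real \<Rightarrow> 'a \<Rightarrow> real"
  assumes f: "integrable lborel f"
    and f_hat: "integrable lborel (fourier (\<lambda>x. complex_of_real (f x)))"
    and lam: "0 \<le> lam"
    and p: "prob_density p"
    and prob_space: "prob_space M"
    and sample_indep: "prob_space.indep_vars M (\<lambda>_. borel) \<omega> {1..}"
    and sample_density: "\<And>k. k \<ge> 1 \<Longrightarrow> distributed M lborel (\<omega> k) (\<lambda>x. ennreal (p x))"
    and rho: "prob_density \<rho>"
    and rho_supp: "supp \<rho> = UNIV"
    and rho_hat: "C_k 1 (fourier (\<lambda>x. complex_of_real (\<rho> x)))"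
    and A3: "open \<U>" "bounded \<U>"
        "supp (fourier (\<lambda>x. complex_of_real (f x))) \<subseteq> supp p" "supp p \<subseteq> \<U>"
    and phi_smooth: "\<And>\<epsilon>. \<epsilon> > 0 \<Longrightarrow> smooth (\<phi> \<epsilon>)"
    and phi_nonneg: "\<And>\<epsilon> w. \<epsilon> > 0 \<Longrightarrow> 0 \<le> \<phi> \<epsilon> w"
    and phi_supp: "\<And>\<epsilon>. \<epsilon> > 0 \<Longrightarrow> supp (\<phi> \<epsilon>) \<subseteq> cball 0 \<epsilon>"
    and phi_integral: "\<And>\<epsilon>. \<epsilon> > 0 \<Longrightarrow> (LINT w|lborel. \<phi> \<epsilon> w) = 1"
  shows "AE s in M. \<forall>\<zeta> :: nat \<Rightarrow> nat \<Rightarrow> complex.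
      (\<forall>K\<ge>1. normal_equations f \<rho> lam (\<lambda>k. \<omega> k s) K (\<zeta> K)) \<longrightarrow>
      (\<exists>C. \<forall>K\<ge>1. (\<Sum>k=1..K. norm (\<zeta> K k)) \<le> C) \<longrightarrow>
      (\<lambda>K. Max ((\<lambda>k. norm (\<zeta> K k)) ` {1..K})) \<longlonglongrightarrow> 0 \<longrightarrow>
      closure ((\<lambda>k. \<omega> k s) ` {1..}) = supp p \<longrightarrow>
      (\<exists>G. (\<forall>\<epsilon>>0. tendsto_L1 (\<lambda>K. mollified p (\<lambda>k. \<omega> k s) K (\<zeta> K) (\<phi> \<epsilon>)) (G \<epsilon>) sequentially) \<and>
        tendsto_L1 G
          (\<lambda>w. complex_of_real ((2 * pi) powr (- (real DIM('a) / 2))) *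
                fourier (\<lambda>x. complex_of_real (f x)) w)
          (at_right 0))"
proof -
  let ?\<nu> = "\<lambda>w. complex_of_real (fourier_norm TYPE('a)) * fourier (\<lambda>x. complex_of_real (f x)) w"
  define G where "G \<epsilon> x = (LINT w'|lborel. ?\<nu> w' * complex_of_real (\<phi> \<epsilon> (x - w')))" for \<epsilon> x
  have phi_cont: "continuous_on UNIV (\<phi> \<epsilon>)" if "\<epsilon> > 0" for \<epsilon>
    using phi_smooth[OF that] C_k.simps(1) unfolding smooth_def by blast
  have phi_zero: "\<phi> \<epsilon> w = 0" if "\<epsilon> > 0" "norm w > \<epsilon>" for \<epsilon> w
  proof (rule ccontr)
    assume "\<phi> \<epsilon> w \<noteq> 0"
    then have "w \<in> cball 0 \<epsilon>"
      using nonzero_imp_in_supp[OF phi_cont[OF that(1)]] phi_supp[OF that(1)] by blast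
    then show False using that(2) by simp
  qed
  have outer: "tendsto_L1 G ?\<nu> (at_right 0)"
    unfolding G_def using f_hat
    by (intro approximate_identity_L1 phi_nonneg phi_zero phi_integral) simp_all
  have "AE s in M. \<forall>k\<ge>1. p (\<omega> k s) \<noteq> 0"
    using p by (intro samples_in_positive_density prob_space sample_density)
      (auto simp: prob_density_def has_bochner_integral_iff)
  then show ?thesis
  proof eventually_elim
    case (elim s)
    show ?case
    proof (intro allI impI)
      fix \<zeta> :: "nat \<Rightarrow> nat \<Rightarrow> complex"
      assume normal: "\<forall>K\<ge>1. normal_equations f \<rho> lam (\<lambda>k. \<omega> k s) K (\<zeta> K)"
        and bound: "\<exists>C. \<forall>K\<ge>1. (\<Sum>k=1..K. norm (\<zeta> K k)) \<le> C"
        and vanish: "(\<lambda>K. Max ((\<lambda>k. norm (\<zeta> K k)) ` {1..K})) \<longlonglongrightarrow> 0"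
        and dense: "closure ((\<lambda>k. \<omega> k s) ` {1..}) = supp p"
      from bound obtain C where C1: "\<And>K. K \<ge> 1 \<Longrightarrow> (\<Sum>k=1..K. norm (\<zeta> K k)) \<le> C" by auto
      have C: "(\<Sum>k=1..K. norm (\<zeta> K k)) \<le> C" for K
      proof (cases "K = 0")
        case True
        then show ?thesis using order_trans[OF _ C1[of 1]] by simp
      qed (use C1 in simp)
      have bdd: "bounded (supp p)" using A3 bounded_subset by blast
      moreover have "closed (supp p)" using closed_closure by (simp flip: dense)
      ultimately have compact: "compact (supp p)" by (simp add: compact_eq_bounded_closed)
      have in_supp: "\<omega> k s \<in> supp p" if "k \<ge> 1" for k
      proof -
        have "\<omega> k s \<in> (\<lambda>k. \<omega> k s) ` {1..}" using that by simp
        then have "\<omega> k s \<in> closure ((\<lambda>k. \<omega> k s) ` {1..})" by (rule subsetD[OF closure_subset])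
        then show ?thesis unfolding dense .
      qed
      have "tendsto_L1 (\<lambda>K. mollified p (\<lambda>k. \<omega> k s) K (\<zeta> K) (\<phi> \<epsilon>)) (G \<epsilon>) sequentially" if "\<epsilon> > 0" for \<epsilon>
        unfolding G_def
      proof (rule mollified_tendsto_L1[OF phi_cont[OF that] phi_zero[OF that] _ bdd in_supp C])
        show "p (\<omega> k s) \<noteq> 0" if "k \<ge> 1" for k using elim that by blast
        show "(\<lambda>K. \<Sum>k=1..K. \<zeta> K k * complex_of_real (g (\<omega> k s)))
            \<longlonglongrightarrow> (LINT w|lborel. ?\<nu> w * complex_of_real (g w))" if "continuous_on UNIV g" for g
          using normal that
          by (intro weak_convergence_of_normal_equations[OF f f_hat lam rho rho_supp compact dense A3(3) _ C vanish]) blast+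
      qed
      with outer show "\<exists>G. (\<forall>\<epsilon>>0. tendsto_L1 (\<lambda>K. mollified p (\<lambda>k. \<omega> k s) K (\<zeta> K) (\<phi> \<epsilon>)) (G \<epsilon>) sequentially) \<and>
        tendsto_L1 G
          (\<lambda>w. complex_of_real ((2 * pi) powr (- (real DIM('a) / 2))) *
                fourier (\<lambda>x. complex_of_real (f x)) w)
          (at_right 0)"
        by (auto simp: fourier_norm_def)
    qed
  qed
qed

end
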